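(* Let $\Omega\subseteq\mathbb{R}^d$ be locally compact Hausdorff, let $q_0$ be a probability density on $\Omega$, and let $k$ be a reproducing kernel on $\Omega$ with RKHS $\mathcal{H}$ and associated family of densities $\mathcal{P}$. Define $$\mathcal{P}_0:=\left\{\pi_f(x)=e^{f(x)-A(f)}q_0(x),\ x\in\Omega\ :\ f\in C_0(\Omega)\right\}.$$ Suppose $k(x,\cdot)\in C_0(\Omega)$ for all $x\in\Omega$ and $$\int\!\!\int k(x,y)\,d\mu(x)\,d\mu(y)>0\qquad\text{for all }\mu\in M_b(\Omega)\setminus\{0\}.$$ Then $\mathcal{P}$ is dense in $\mathcal{P}_0$ with respect to the Kullback-Leibler divergence, the total variation ($L^1$ norm) distance and the Hellinger distance. In addition, if $q_0\in L^1(\Omega)\cap L^r(\Omega)$ for some $1<r\le\infty$, then $\mathcal{P}$ is also dense in $\mathcal{P}_0$ with respect to the $L^r$ norm.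
   Context: For a measurable function $f$ on $\Omega$, $A(f):=\log\int_\Omega e^{f(x)}q_0(x)\,dx$. $\mathcal{H}$ is the reproducing kernel Hilbert space (RKHS) of functions on $\Omega$ with reproducing kernel $k$ (real-valued, symmetric, positive definite); $\mathcal{F}:=\{f\in\mathcal{H}: e^{A(f)}<\infty\}$ and $\mathcal{P}:=\{p_f(x)=e^{f(x)-A(f)}q_0(x),\ x\in\Omega: f\in\mathcal{F}\}$. $C_0(\Omega)$ is the space of continuous functions on $\Omega$ vanishing at infinity (i.e. $\{x:|f(x)|\ge\epsilon\}$ is compact for every $\epsilon>0$). $M_b(\Omega)$ is the set of all finite signed Borel measures on $\Omega$. For probability densities $p,q$ on $\Omega$: $KL(p\|q)=\int p\log\frac{p}{q}\,dx$, the Hellinger distance is $h(p,q)=\|\sqrt p-\sqrt q\|_{L^2(\Omega)}$, the total variation distance is $\|p-q\|_{L^1(\Omega)}$. "$\mathcal{P}$ is dense in $\mathcal{P}_0$ w.r.t. $D$" means: for every $\pi\in\mathcal{P}_0$ and $\epsilon>0$ there is $p\in\mathcal{P}$ with $D(\pi,p)\le\epsilon$ (for KL: $KL(\pi\|p)\le\epsilon$). *)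

theory Defs
  imports "HOL-Probability.Essential_Supremum"
begin

text \<open>A function on \<open>\<Omega>\<close> is a function on the whole type. Its values off \<open>\<Omega>\<close> play no role, except
  that the elements of an RKHS are normalised to vanish there, so that equality of functions on
  \<open>\<Omega>\<close> is equality in HOL.\<close>

definition positive_definite_kernel :: "'a set \<Rightarrow> ('a \<Rightarrow> 'a \<Rightarrow> real) \<Rightarrow> bool" where
  "positive_definite_kernel \<Omega> k \<longleftrightarrow>
     (\<forall>x\<in>\<Omega>. \<forall>y\<in>\<Omega>. k x y = k y x) \<and>
     (\<forall>S c. finite S \<longrightarrow> S \<subseteq> \<Omega> \<longrightarrow> 0 \<le> (\<Sum>x\<in>S. \<Sum>y\<in>S. c x * c y * k x y))"

text \<open>\<open>H\<close> with inner product \<open>ip\<close> is the reproducing kernel Hilbert space of \<open>k\<close>. By the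
  Moore-Aronszajn theorem it exists and is unique for every positive definite kernel (\<open>ip\<close> up to
  its irrelevant values outside \<open>H\<close>).\<close>

locale rkhs =
  fixes \<Omega> :: "'a set"
    and k :: "'a \<Rightarrow> 'a \<Rightarrow> real"
    and H :: "('a \<Rightarrow> real) set"
    and ip :: "('a \<Rightarrow> real) \<Rightarrow> ('a \<Rightarrow> real) \<Rightarrow> real"
  assumes vanishes_off: "f \<in> H \<Longrightarrow> x \<notin> \<Omega> \<Longrightarrow> f x = 0"
    and zero_mem: "(\<lambda>x. 0) \<in> H"
    and add_mem: "f \<in> H \<Longrightarrow> g \<in> H \<Longrightarrow> (\<lambda>x. f x + g x) \<in> H"
    and scale_mem: "f \<in> H \<Longrightarrow> (\<lambda>x. c * f x) \<in> H"
    and ip_commute: "f \<in> H \<Longrightarrow> g \<in> H \<Longrightarrow> ip f g = ip g f"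
    and ip_add: "f \<in> H \<Longrightarrow> g \<in> H \<Longrightarrow> h \<in> H \<Longrightarrow> ip (\<lambda>x. f x + g x) h = ip f h + ip g h"
    and ip_scale: "f \<in> H \<Longrightarrow> g \<in> H \<Longrightarrow> ip (\<lambda>x. c * f x) g = c * ip f g"
    and ip_nonneg: "f \<in> H \<Longrightarrow> 0 \<le> ip f f"
    and ip_definite: "f \<in> H \<Longrightarrow> ip f f = 0 \<Longrightarrow> f = (\<lambda>x. 0)"
    and complete: "(\<And>n. F n \<in> H) \<Longrightarrow>
      (\<And>e. e > 0 \<Longrightarrow> \<exists>N. \<forall>m\<ge>N. \<forall>n\<ge>N. sqrt (ip (\<lambda>x. F m x - F n x) (\<lambda>x. F m x - F n x)) < e) \<Longrightarrow>
      \<exists>g\<in>H. (\<lambda>n::nat. sqrt (ip (\<lambda>x. F n x - g x) (\<lambda>x. F n x - g x))) \<longlonglongrightarrow> 0"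
    and section_mem: "x \<in> \<Omega> \<Longrightarrow> (\<lambda>y. if y \<in> \<Omega> then k x y else 0) \<in> H"
    and reproducing: "x \<in> \<Omega> \<Longrightarrow> f \<in> H \<Longrightarrow> f x = ip f (\<lambda>y. if y \<in> \<Omega> then k x y else 0)"

definition C0 :: "'a::topological_space set \<Rightarrow> ('a \<Rightarrow> real) set" where
  "C0 \<Omega> = {f. continuous_on \<Omega> f \<and> (\<forall>\<epsilon>>0. compact {x\<in>\<Omega>. \<epsilon> \<le> \<bar>f x\<bar>})}"

text \<open>Real-valued signed measures are extended by \<open>0\<close> to non-measurable sets, so that the zero
  measure is the constant function \<open>0\<close>.\<close>

definition signed_measures :: "'b measure \<Rightarrow> ('b set \<Rightarrow> real) set" where
  "signed_measures M = {\<mu>. \<mu> {} = 0 \<and>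
     (\<forall>A. range A \<subseteq> sets M \<longrightarrow> disjoint_family A \<longrightarrow> (\<lambda>i::nat. \<mu> (A i)) sums \<mu> (\<Union>i. A i)) \<and>
     (\<forall>A. A \<notin> sets M \<longrightarrow> \<mu> A = 0)}"

definition Mb :: "'a::topological_space set \<Rightarrow> ('a set \<Rightarrow> real) set" where
  "Mb \<Omega> = signed_measures (restrict_space borel \<Omega>)"

text \<open>The positive part of the Jordan decomposition. Negative values of \<open>\<mu>\<close> are truncated to \<open>0\<close> by
  \<open>ennreal\<close>, which does not change the supremum since \<open>B = {}\<close> contributes \<open>0\<close>.\<close>

definition pos_part :: "'b measure \<Rightarrow> ('b set \<Rightarrow> real) \<Rightarrow> 'b measure" where
  "pos_part M \<mu> = measure_of (space M) (sets M) (\<lambda>A. SUP B\<in>{B\<in>sets M. B \<subseteq> A}. ennreal (\<mu> B))"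

definition signed_integral :: "'b measure \<Rightarrow> ('b set \<Rightarrow> real) \<Rightarrow> ('b \<Rightarrow> real) \<Rightarrow> real" where
  "signed_integral M \<mu> f =
     (\<integral>x. f x \<partial>pos_part M \<mu>) - (\<integral>x. f x \<partial>pos_part M (\<lambda>A. - \<mu> A))"

definition probability_density_on :: "'a::euclidean_space set \<Rightarrow> ('a \<Rightarrow> real) \<Rightarrow> bool" where
  "probability_density_on \<Omega> q \<longleftrightarrow> q \<in> borel_measurable (lebesgue_on \<Omega>) \<and>
     (\<forall>x\<in>\<Omega>. 0 \<le> q x) \<and> (\<integral>\<^sup>+x. ennreal (q x) \<partial>lebesgue_on \<Omega>) = 1"

text \<open>\<open>exp_A \<Omega> q0 f\<close> is \<open>e\<^bsup>A(f)\<^esup>\<close>, possibly infinite; \<open>log_partition\<close> is meaningful where it is finite.\<close>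

definition exp_A :: "'a::euclidean_space set \<Rightarrow> ('a \<Rightarrow> real) \<Rightarrow> ('a \<Rightarrow> real) \<Rightarrow> ennreal" where
  "exp_A \<Omega> q0 f = (\<integral>\<^sup>+x. ennreal (exp (f x) * q0 x) \<partial>lebesgue_on \<Omega>)"

definition log_partition :: "'a::euclidean_space set \<Rightarrow> ('a \<Rightarrow> real) \<Rightarrow> ('a \<Rightarrow> real) \<Rightarrow> real" where
  "log_partition \<Omega> q0 f = ln (enn2real (exp_A \<Omega> q0 f))"

definition exp_density ::
  "'a::euclidean_space set \<Rightarrow> ('a \<Rightarrow> real) \<Rightarrow> ('a \<Rightarrow> real) \<Rightarrow> 'a \<Rightarrow> real" where
  "exp_density \<Omega> q0 f x = exp (f x - log_partition \<Omega> q0 f) * q0 x"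

definition exp_family ::
  "'a::euclidean_space set \<Rightarrow> ('a \<Rightarrow> real) \<Rightarrow> ('a \<Rightarrow> real) set \<Rightarrow> ('a \<Rightarrow> real) set" where
  "exp_family \<Omega> q0 H = exp_density \<Omega> q0 ` {f \<in> H. exp_A \<Omega> q0 f < \<infinity>}"

definition C0_family ::
  "'a::euclidean_space set \<Rightarrow> ('a \<Rightarrow> real) \<Rightarrow> ('a \<Rightarrow> real) set" where
  "C0_family \<Omega> q0 = exp_density \<Omega> q0 ` C0 \<Omega>"

text \<open>For probability densities the negative part of \<open>p log (p/q)\<close> is always integrable, so the
  integral is \<open>+\<infinity>\<close> when it is not finite. Points with \<open>p = 0\<close> contribute \<open>0\<close>; if \<open>q = 0 < p\<close> on a
  set of positive measure the divergence is \<open>+\<infinity>\<close>, which has to be stated as \<open>ln (p/0) = 0\<close> in HOL.\<close>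

definition KL :: "'a::euclidean_space set \<Rightarrow> ('a \<Rightarrow> real) \<Rightarrow> ('a \<Rightarrow> real) \<Rightarrow> ereal" where
  "KL \<Omega> p q =
     (if (AE x in lebesgue_on \<Omega>. q x = 0 \<longrightarrow> p x = 0) \<and>
         integrable (lebesgue_on \<Omega>) (\<lambda>x. p x * ln (p x / q x))
      then ereal (\<integral>x. p x * ln (p x / q x) \<partial>lebesgue_on \<Omega>) else \<infinity>)"

definition Lp_norm :: "ennreal \<Rightarrow> 'b measure \<Rightarrow> ('b \<Rightarrow> real) \<Rightarrow> ennreal" where
  "Lp_norm r M u =
     (if r = \<infinity> then esssup M (\<lambda>x. ennreal \<bar>u x\<bar>)
      else (let I = (\<integral>\<^sup>+x. ennreal (\<bar>u x\<bar> powr enn2real r) \<partial>M)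
            in if I = \<infinity> then \<infinity> else ennreal (enn2real I powr (1 / enn2real r))))"

definition Lp_space :: "ennreal \<Rightarrow> 'b measure \<Rightarrow> ('b \<Rightarrow> real) set" where
  "Lp_space r M = {u \<in> borel_measurable M. Lp_norm r M u < \<infinity>}"

definition Lr_dist ::
  "ennreal \<Rightarrow> 'a::euclidean_space set \<Rightarrow> ('a \<Rightarrow> real) \<Rightarrow> ('a \<Rightarrow> real) \<Rightarrow> ereal" where
  "Lr_dist r \<Omega> p q = enn2ereal (Lp_norm r (lebesgue_on \<Omega>) (\<lambda>x. p x - q x))"

definition TV_dist :: "'a::euclidean_space set \<Rightarrow> ('a \<Rightarrow> real) \<Rightarrow> ('a \<Rightarrow> real) \<Rightarrow> ereal" where
  "TV_dist \<Omega> p q = Lr_dist 1 \<Omega> p q"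

definition Hellinger_dist :: "'a::euclidean_space set \<Rightarrow> ('a \<Rightarrow> real) \<Rightarrow> ('a \<Rightarrow> real) \<Rightarrow> ereal" where
  "Hellinger_dist \<Omega> p q = Lr_dist 2 \<Omega> (\<lambda>x. sqrt (p x)) (\<lambda>x. sqrt (q x))"

definition dense_wrt :: "('c \<Rightarrow> 'c \<Rightarrow> ereal) \<Rightarrow> 'c set \<Rightarrow> 'c set \<Rightarrow> bool" where
  "dense_wrt D P P0 \<longleftrightarrow> (\<forall>\<pi>\<in>P0. \<forall>\<epsilon>::real. \<epsilon> > 0 \<longrightarrow> (\<exists>p\<in>P. D \<pi> p \<le> ereal \<epsilon>))"

end

theory Submission
  imports Defs "HOL-Probability.Discrete_Topology"
begin

text \<open>The proof has two independent halves.

  The first is that \<open>H\<close> is dense in \<open>C0 \<Omega>\<close> for the supremum norm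
  (\<open>kernel_sections_dense_in_C0\<close>); this is where the hypothesis on \<open>k\<close> enters. If the span of the
  sections \<open>k x\<close> were not dense, the Hahn-Banach theorem would give a bounded functional that vanishes
  on all sections but not on all of \<open>C0 \<Omega>\<close>. By the Riesz representation theorem this functional is the
  integral against a nonzero \<open>\<mu> \<in> Mb \<Omega>\<close>. Then \<open>\<integral> k x y d\<mu>(x) = 0\<close> for all \<open>y\<close>, and the double integral
  of \<open>k\<close> is zero instead of positive.

  The Hahn-Banach theorem is used in its sublinear form, on functions on two disjoint copies of \<open>\<Omega>\<close> and
  with a one-sided supremum as the dominating functional. In this way the separating functional is
  obtained directly as a difference of two positive ones (\<open>separating_positive_functionals\<close>). Each
  of them is represented by a finite measure, constructed by covering sets with sequences of
  functions in the manner of Daniell (\<open>positive_C0_functional.integral_riesz\<close>). The difference of the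
  two measures is \<open>\<mu>\<close>; that its integral, defined through the Jordan decomposition, is the difference of
  the two integrals is \<open>signed_integral_diff_measure\<close>.

  The second half is that the map from exponents to densities is continuous. If \<open>f\<close> and \<open>g\<close> are
  uniformly \<open>e\<close>-close, then \<open>A f\<close> and \<open>A g\<close> differ by at most \<open>e\<close>, and the quotient of the two densities lies
  between \<open>exp (- 2 e)\<close> and \<open>exp (2 e)\<close>. Hence the Kullback-Leibler divergence is at most \<open>2 e\<close>, the
  Hellinger distance at most \<open>exp e - 1\<close>, and the \<open>L\<^sup>r\<close> distance at most \<open>exp (2 e) - 1\<close> times the \<open>L\<^sup>r\<close>
  norm of the density of \<open>f\<close>, which is a bounded multiple of \<open>q0\<close>; \<open>r = 1\<close> is the total variation.\<close>

section \<open>The Hahn-Banach theorem for sublinear functionals\<close>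

definition sublinear :: "('v::real_vector \<Rightarrow> real) \<Rightarrow> bool" where
  "sublinear p \<longleftrightarrow> (\<forall>x y. p (x + y) \<le> p x + p y) \<and> (\<forall>c x. 0 \<le> c \<longrightarrow> p (c *\<^sub>R x) = c * p x)"

lemma sublinearD:
  assumes "sublinear p"
  shows "p (x + y) \<le> p x + p y" and "0 \<le> c \<Longrightarrow> p (c *\<^sub>R x) = c * p x"
    and "p 0 = 0" and "- p (- x) \<le> p x"
proof -
  show 1: "p (x + y) \<le> p x + p y" for x y
    using assms by (simp add: sublinear_def)
  show 2: "0 \<le> c \<Longrightarrow> p (c *\<^sub>R x) = c * p x" for c x
    using assms by (simp add: sublinear_def)
  show 3: "p 0 = 0"
    using 2[of 0 0] by simp
  show "- p (- x) \<le> p x"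
    using 1[of x "- x"] 3 by simp
qed

lemma sublinearI:
  assumes add: "\<And>x y. p (x + y) \<le> p x + p y" and zero: "p 0 = 0"
    and scale_le: "\<And>c x. 0 < c \<Longrightarrow> p (c *\<^sub>R x) \<le> c * p x"
  shows "sublinear p"
proof -
  have "p (c *\<^sub>R x) = c * p x" if "0 \<le> c" for c x
  proof (cases "c = 0")
    case False
    then have c: "0 < c" using that by simp
    have "p x \<le> p (c *\<^sub>R x) / c"
      using scale_le[of "1 / c" "c *\<^sub>R x"] c by simp
    then show ?thesis using scale_le[OF c, of x] c by (simp add: field_simps)
  qed (simp add: zero)
  then show ?thesis using add by (simp add: sublinear_def)
qed

text \<open>The infimum of \<open>q (x + t y) - t q y\<close> over \<open>t \<ge> 0\<close> is the part of \<open>q\<close> that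
  is left when \<open>q\<close> is forced to be linear along the ray through \<open>y\<close>. Applied to a minimal \<open>q\<close> it
  changes nothing, which is how minimal sublinear functionals turn out to be linear; applied to
  the given functional first, it makes every linear minorant attain the value \<open>q y\<close> at \<open>y\<close>.\<close>
lemma sublinear_lower:
  fixes q :: "'v::real_vector \<Rightarrow> real"
  assumes q: "sublinear q"
  shows "\<exists>q'. sublinear q' \<and> (\<forall>x. q' x \<le> q x) \<and> q' (- y) \<le> - q y"
proof -
  define r where "r x t = q (x + t *\<^sub>R y) - t * q y" for x t
  define q' where "q' x = (INF t\<in>{0..}. r x t)" for x
  have bdd: "bdd_below (r x ` {0..})" for x
  \<comment> \<open>subadditivity at \<open>(x + t y) + (- x) = t y\<close> bounds the family below by \<open>- q (- x)\<close>\<close>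
  proof (rule bdd_belowI2)
    fix t :: real assume "t \<in> {0..}"
    then have "t * q y = q ((x + t *\<^sub>R y) + - x)"
      using sublinearD(2)[OF q, of t y] by simp
    also have "\<dots> \<le> q (x + t *\<^sub>R y) + q (- x)"
      by (rule sublinearD(1)[OF q])
    finally show "- q (- x) \<le> r x t" by (simp add: r_def)
  qed
  have le: "q' x \<le> r x t" if "0 \<le> t" for x t
    unfolding q'_def by (rule cINF_lower[OF bdd]) (use that in simp)
  have ge: "b \<le> q' x" if "\<And>t. 0 \<le> t \<Longrightarrow> b \<le> r x t" for b x
    unfolding q'_def by (rule cINF_greatest) (use that in auto)
  have add: "q' (x + z) \<le> q' x + q' z" for x z
  proof -
    have *: "q' (x + z) \<le> r x s + r z t" if "0 \<le> s" "0 \<le> t" for s t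
    proof -
      have "q' (x + z) \<le> r (x + z) (s + t)" using that by (intro le) simp
      also have "\<dots> = q ((x + s *\<^sub>R y) + (z + t *\<^sub>R y)) - (s + t) * q y"
        by (simp add: r_def algebra_simps)
      also have "\<dots> \<le> r x s + r z t"
        using sublinearD(1)[OF q, of "x + s *\<^sub>R y" "z + t *\<^sub>R y"] by (simp add: r_def algebra_simps)
      finally show ?thesis .
    qed
    have "q' (x + z) - r x s \<le> q' z" if "0 \<le> s" for s
      using *[OF that] by (intro ge) (simp add: algebra_simps)
    then have "q' (x + z) - q' z \<le> q' x"
      by (intro ge) (simp add: algebra_simps)
    then show ?thesis by simp
  qed
  have scale_le: "q' (c *\<^sub>R x) \<le> c * q' x" if "0 < c" for c x
  proof -
    have "q' (c *\<^sub>R x) / c \<le> q' x"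
    proof (rule ge)
      fix t :: real assume t: "0 \<le> t"
      have "q' (c *\<^sub>R x) \<le> r (c *\<^sub>R x) (c * t)" using t that by (intro le) simp
      also have "\<dots> = c * r x t"
        using sublinearD(2)[OF q, of c "x + t *\<^sub>R y"] that by (simp add: r_def algebra_simps)
      finally show "q' (c *\<^sub>R x) / c \<le> r x t" using that by (simp add: field_simps)
    qed
    then show ?thesis using that by (simp add: field_simps)
  qed
  have zero: "q' 0 = 0"
  proof (rule antisym)
    show "q' 0 \<le> 0" using le[of 0 0] sublinearD(3)[OF q] by (simp add: r_def)
    show "0 \<le> q' 0" by (rule ge) (simp add: r_def sublinearD(2)[OF q])
  qed
  have "q' (- y) \<le> r (- y) 1" by (rule le) simp
  then have "q' (- y) \<le> - q y" by (simp add: r_def sublinearD(3)[OF q])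
  moreover have "q' x \<le> q x" for x using le[of 0 x] by (simp add: r_def)
  ultimately show ?thesis using sublinearI[OF add zero scale_le] by blast
qed

text \<open>Zorn's lemma downwards: a chain of sublinear minorants of \<open>p\<close> is bounded below pointwise by
  \<open>- p (- x)\<close>, so its pointwise infimum is real-valued, and it is sublinear because any two members
  of the chain lie above a common one.\<close>
lemma minimal_sublinear_exists:
  fixes p :: "'v::real_vector \<Rightarrow> real"
  assumes p: "sublinear p"
  shows "\<exists>m. sublinear m \<and> m \<le> p \<and> (\<forall>q. sublinear q \<longrightarrow> q \<le> m \<longrightarrow> q = m)"
proof -
  define A where "A = {q. sublinear q \<and> q \<le> p}"
  have "\<exists>m\<in>A. \<forall>a\<in>A. a \<le> m \<longrightarrow> a = m"
  proof (rule predicate_Zorn)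
    show "partial_order_on A (relation_of (\<lambda>a b. b \<le> a) A)"
      by (auto simp: partial_order_on_def preorder_on_def refl_on_def relation_of_def
          intro!: transI antisymI)
    fix C assume C: "C \<in> Chains (relation_of (\<lambda>a b. b \<le> a) A)"
    have CA: "C \<subseteq> A"
      using C by (auto simp: Chains_def relation_of_def)
    have lin: "a \<le> b \<or> b \<le> a" if "a \<in> C" "b \<in> C" for a b
      using C that by (auto simp: Chains_def relation_of_def)
    show "\<exists>u\<in>A. \<forall>a\<in>C. u \<le> a"
    proof (cases "C = {}")
      case True then show ?thesis using p by (auto simp: A_def)
    next
      case False
      define u where "u x = (INF q\<in>C. q x)" for x
      have sub: "sublinear a" and ap: "a x \<le> p x" if "a \<in> C" for a x
        using that CA by (auto simp: A_def le_fun_def)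
      have bdd: "bdd_below ((\<lambda>q. q x) ` C)" for x
      proof (rule bdd_belowI2)
        fix a assume a: "a \<in> C"
        show "- p (- x) \<le> a x"
          using sublinearD(4)[OF sub[OF a], of x] ap[OF a, of "- x"] by simp
      qed
      have le: "u x \<le> a x" if "a \<in> C" for a x
        unfolding u_def by (rule cINF_lower[OF bdd that])
      have ge: "b \<le> u x" if "\<And>a. a \<in> C \<Longrightarrow> b \<le> a x" for b x
        unfolding u_def by (rule cINF_greatest) (use that False in auto)
      have add: "u (x + z) \<le> u x + u z" for x z
      proof -
        have *: "u (x + z) \<le> a x + b z" if ab: "a \<in> C" "b \<in> C" for a b
        proof -
          obtain m where m: "m \<in> C" "m \<le> a" "m \<le> b" using lin[OF ab] ab by auto
          have "u (x + z) \<le> m (x + z)" by (rule le[OF m(1)])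
          also have "\<dots> \<le> m x + m z" by (rule sublinearD(1)[OF sub[OF m(1)]])
          also have "\<dots> \<le> a x + b z" using m by (auto simp: le_fun_def intro: add_mono)
          finally show ?thesis .
        qed
        have "u (x + z) - a x \<le> u z" if "a \<in> C" for a
          using *[OF that] by (intro ge) (simp add: algebra_simps)
        then have "u (x + z) - u z \<le> u x"
          by (intro ge) (simp add: algebra_simps)
        then show ?thesis by simp
      qed
      have scale_le: "u (c *\<^sub>R x) \<le> c * u x" if "0 < c" for c x
      proof -
        have "u (c *\<^sub>R x) / c \<le> u x"
        proof (rule ge)
          fix a assume a: "a \<in> C"
          show "u (c *\<^sub>R x) / c \<le> a x"
            using le[OF a, of "c *\<^sub>R x"] sublinearD(2)[OF sub[OF a], of c x] that
            by (simp add: field_simps)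
        qed
        then show ?thesis using that by (simp add: field_simps)
      qed
      have zero: "u 0 = 0"
      proof (rule antisym)
        obtain a where a: "a \<in> C" using False by auto
        show "u 0 \<le> 0" using le[OF a, of 0] sublinearD(3)[OF sub[OF a]] by simp
        show "0 \<le> u 0" by (rule ge) (simp add: sublinearD(3)[OF sub])
      qed
      obtain a where a: "a \<in> C" using False by auto
      have "u \<le> p" using le[OF a] ap[OF a] by (auto simp: le_fun_def intro: order_trans)
      then have "u \<in> A" using sublinearI[OF add zero scale_le] by (auto simp: A_def)
      moreover have "\<forall>a\<in>C. u \<le> a" using le by (auto simp: le_fun_def)
      ultimately show ?thesis by blast
    qed
  qed
  then obtain m where m: "m \<in> A" "\<And>a. a \<in> A \<Longrightarrow> a \<le> m \<Longrightarrow> a = m" by blast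
  have "q = m" if "sublinear q" "q \<le> m" for q
    using m that by (auto simp: A_def intro: order_trans)
  then show ?thesis using m(1) by (auto simp: A_def)
qed

text \<open>A minimal \<open>m\<close> equals each of its own lowerings, hence \<open>m (- z) = - m z\<close> for all \<open>z\<close>; a sublinear
  functional that is odd is linear. Starting the descent from the lowering of \<open>p\<close> at \<open>y\<close> gives the
  supporting functional at \<open>y\<close>.\<close>
theorem Hahn_Banach_sublinear:
  fixes p :: "'v::real_vector \<Rightarrow> real"
  assumes p: "sublinear p"
  shows "\<exists>J. linear J \<and> (\<forall>x. J x \<le> p x) \<and> J y = p y"
proof -
  obtain p' where p': "sublinear p'" "\<And>x. p' x \<le> p x" "p' (- y) \<le> - p y"
    using sublinear_lower[OF p] by blast
  obtain m where m: "sublinear m" "m \<le> p'"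
      and min: "\<And>q. sublinear q \<Longrightarrow> q \<le> m \<Longrightarrow> q = m"
    using minimal_sublinear_exists[OF p'(1)] by blast
  have neg: "m (- z) = - m z" for z
  proof -
    obtain q where q: "sublinear q" "\<And>x. q x \<le> m x" "q (- z) \<le> - m z"
      using sublinear_lower[OF m(1)] by blast
    then have "q = m" by (intro min) (auto simp: le_fun_def)
    then show ?thesis using q(3) sublinearD(4)[OF m(1), of z] by simp
  qed
  have add: "m (x + z) = m x + m z" for x z
    using sublinearD(1)[OF m(1), of x z] sublinearD(1)[OF m(1), of "- x" "- z"] neg[of "x + z"]
    by (simp add: neg)
  have scale: "m (c *\<^sub>R x) = c * m x" for c x
  proof (cases "0 \<le> c")
    case True then show ?thesis by (rule sublinearD(2)[OF m(1)])
  next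
    case False
    then have "m ((- c) *\<^sub>R x) = - c * m x" by (intro sublinearD(2)[OF m(1)]) simp
    then show ?thesis using neg[of "c *\<^sub>R x"] by simp
  qed
  have mp: "m x \<le> p x" for x
    using m(2) p'(2) by (auto simp: le_fun_def intro: order_trans)
  have "m y = p y"
    using mp[of y] m(2) p'(3) neg[of y] by (auto simp: le_fun_def dest: spec[of _ "- y"])
  then show ?thesis
    using add scale mp by (intro exI[of _ m]) (auto intro: linearI)
qed

section \<open>Separation by two positive functionals\<close>

text \<open>A bounded functional that vanishes on \<open>V\<close> but not at \<open>f0\<close> is wanted as a difference of two
  positive ones. This comes out of a single application of Hahn-Banach on pairs \<open>(F, G)\<close>, thought of
  as functions on two copies of the space: the functional \<open>p\<close> below is the one-sided supremum norm
  \<open>max 0 (sup F) (sup G)\<close>, made invariant under the antidiagonal \<open>{(v, - v). v \<in> V}\<close>. Domination by a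
  one-sided norm is positivity, invariance forces the two components of the dominated linear
  functional to agree on \<open>V\<close>, and on \<open>(f0, - f0)\<close> the value of \<open>p\<close> is the distance from \<open>f0\<close> to \<open>V\<close>.\<close>
theorem separating_positive_functionals:
  fixes V :: "('b::topological_space \<Rightarrow>\<^sub>C real) set"
  assumes V: "subspace V" and f0: "f0 \<notin> closure V"
  obtains I J :: "('b \<Rightarrow>\<^sub>C real) \<Rightarrow> real"
    where "linear I" and "linear J"
      and "\<And>f c. 0 \<le> c \<Longrightarrow> (\<And>x. apply_bcontfun f x \<le> c) \<Longrightarrow> I f \<le> c"
      and "\<And>f c. 0 \<le> c \<Longrightarrow> (\<And>x. apply_bcontfun f x \<le> c) \<Longrightarrow> J f \<le> c"
      and "\<And>v. v \<in> V \<Longrightarrow> I v = J v"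
      and "I f0 \<noteq> J f0"
proof -
  define S where "S F = {c. 0 \<le> c \<and> (\<exists>v\<in>V. \<forall>x. apply_bcontfun (fst F) x + apply_bcontfun v x \<le> c \<and> apply_bcontfun (snd F) x - apply_bcontfun v x \<le> c)}"
    for F :: "('b \<Rightarrow>\<^sub>C real) \<times> ('b \<Rightarrow>\<^sub>C real)"
  define p where "p F = Inf (S F)" for F
  have V0: "0 \<in> V" using V by (rule subspace_0)
  have S0: "c \<in> S F" if "0 \<le> c" "\<And>x. apply_bcontfun (fst F) x \<le> c" "\<And>x. apply_bcontfun (snd F) x \<le> c" for c F
    using that V0 by (auto simp: S_def intro!: bexI[of _ 0])
  have ne: "S F \<noteq> {}" for F
  proof -
    have "norm (fst F) + norm (snd F) \<in> S F"
    proof (rule S0)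
      fix x
      show "apply_bcontfun (fst F) x \<le> norm (fst F) + norm (snd F)"
        using norm_bounded[of "fst F" x] norm_ge_zero[of "snd F"] unfolding real_norm_def by linarith
      show "apply_bcontfun (snd F) x \<le> norm (fst F) + norm (snd F)"
        using norm_bounded[of "snd F" x] norm_ge_zero[of "fst F"] unfolding real_norm_def by linarith
    qed simp
    then show ?thesis by blast
  qed
  have bdd: "bdd_below (S F)" for F by (rule bdd_belowI[of _ 0]) (simp add: S_def)
  have le: "p F \<le> c" if "c \<in> S F" for c F
    unfolding p_def by (rule cInf_lower[OF that bdd])
  have ge: "b \<le> p F" if "\<And>c. c \<in> S F \<Longrightarrow> b \<le> c" for b F
    unfolding p_def by (rule cInf_greatest[OF ne that])
  have S_add: "c + d \<in> S (F + G)" if cd: "c \<in> S F" "d \<in> S G" for c d F G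
  proof -
    obtain v w where v: "v \<in> V" "\<And>x. apply_bcontfun (fst F) x + apply_bcontfun v x \<le> c \<and> apply_bcontfun (snd F) x - apply_bcontfun v x \<le> c"
      and w: "w \<in> V" "\<And>x. apply_bcontfun (fst G) x + apply_bcontfun w x \<le> d \<and> apply_bcontfun (snd G) x - apply_bcontfun w x \<le> d"
      using cd unfolding S_def by blast
    have "\<forall>x. apply_bcontfun (fst (F + G)) x + apply_bcontfun (v + w) x \<le> c + d \<and> apply_bcontfun (snd (F + G)) x - apply_bcontfun (v + w) x \<le> c + d"
      using v(2) w(2) by (auto simp: algebra_simps) (smt (verit))+
    moreover have "v + w \<in> V" by (rule subspace_add[OF V v(1) w(1)])
    moreover have "0 \<le> c + d" using cd by (simp add: S_def)
    ultimately show ?thesis unfolding S_def by blast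
  qed
  have S_scale: "a * c \<in> S (a *\<^sub>R F)" if ca: "c \<in> S F" "0 \<le> a" for a c F
  proof -
    obtain v where v: "v \<in> V" "\<And>x. apply_bcontfun (fst F) x + apply_bcontfun v x \<le> c \<and> apply_bcontfun (snd F) x - apply_bcontfun v x \<le> c"
      using ca unfolding S_def by blast
    have "\<forall>x. apply_bcontfun (fst (a *\<^sub>R F)) x + apply_bcontfun (a *\<^sub>R v) x \<le> a * c \<and> apply_bcontfun (snd (a *\<^sub>R F)) x - apply_bcontfun (a *\<^sub>R v) x \<le> a * c"
    proof
      fix x
      show "apply_bcontfun (fst (a *\<^sub>R F)) x + apply_bcontfun (a *\<^sub>R v) x \<le> a * c \<and> apply_bcontfun (snd (a *\<^sub>R F)) x - apply_bcontfun (a *\<^sub>R v) x \<le> a * c"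
        using mult_left_mono[of "apply_bcontfun (fst F) x + apply_bcontfun v x" c a] mult_left_mono[of "apply_bcontfun (snd F) x - apply_bcontfun v x" c a] v(2)[of x] that(2)
        by (simp add: algebra_simps)
    qed
    moreover have "a *\<^sub>R v \<in> V" by (rule subspace_scale[OF V v(1)])
    moreover have "0 \<le> a * c" using ca by (simp add: S_def)
    ultimately show ?thesis unfolding S_def by blast
  qed
  have add: "p (F + G) \<le> p F + p G" for F G
  proof -
    have "p (F + G) - c \<le> p G" if c: "c \<in> S F" for c
    proof (rule ge)
      fix d assume "d \<in> S G"
      from le[OF S_add[OF c this]] show "p (F + G) - c \<le> d" by linarith
    qed
    then have "p (F + G) - p G \<le> p F" by (intro ge) (simp add: algebra_simps)
    then show ?thesis by simp
  qed
  have scale_le: "p (a *\<^sub>R F) \<le> a * p F" if "0 < a" for a F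
  proof -
    have "p (a *\<^sub>R F) / a \<le> p F"
    proof (rule ge)
      fix c assume "c \<in> S F"
      then show "p (a *\<^sub>R F) / a \<le> c"
        using le[OF S_scale[of c F a]] that by (simp add: field_simps)
    qed
    then show ?thesis using that by (simp add: field_simps)
  qed
  have p_nonneg: "0 \<le> p F" for F by (rule ge) (simp add: S_def)
  have zero: "p 0 = 0"
    using le[of 0 0] S0[of 0 0] p_nonneg[of 0] by simp
  have "sublinear p" using add zero scale_le by (rule sublinearI)
  then obtain L where L: "linear L" "\<And>F. L F \<le> p F" "L (f0, - f0) = p (f0, - f0)"
    using Hahn_Banach_sublinear by blast
  have pos: "0 < p (f0, - f0)"
  proof -
    obtain e where e: "e > 0" "\<And>v. v \<in> V \<Longrightarrow> e \<le> dist v f0"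
      using f0 unfolding closure_approachable by (auto simp: not_less)
    have "e \<le> p (f0, - f0)"
    proof (rule ge)
      fix c assume "c \<in> S (f0, - f0)"
      then obtain v where v: "v \<in> V" "\<And>x. f0 x + apply_bcontfun v x \<le> c \<and> - f0 x - apply_bcontfun v x \<le> c"
        unfolding S_def by auto
      have "dist (- v) f0 \<le> c"
      proof (rule dist_bound)
        fix x show "dist (apply_bcontfun (- v) x) (f0 x) \<le> c" using v(2)[of x] by (simp add: dist_real_def abs_le_iff)
      qed
      moreover have "- v \<in> V" by (rule subspace_neg[OF V v(1)])
      ultimately show "e \<le> c" using e(2) by force
    qed
    then show ?thesis using e(1) by simp
  qed
  have split: "L (F, G) = L (F, 0) + L (0, G)" for F G
    using linear_add[OF L(1), of "(F, 0)" "(0, G)"] by simp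
  have neg: "L (0, - G) = - L (0, G)" for G
    using linear_neg[OF L(1), of "(0, G)"] by simp
  show thesis
  proof (rule that[of "\<lambda>F. L (F, 0)" "\<lambda>F. L (0, F)"])
    show "linear (\<lambda>F. L (F, 0))"
      using linear_add[OF L(1), of "(_, 0)" "(_, 0)"] linear_scale[OF L(1), of _ "(_, 0)"]
      by (intro linearI) auto
    show "linear (\<lambda>F. L (0, F))"
      using linear_add[OF L(1), of "(0, _)" "(0, _)"] linear_scale[OF L(1), of _ "(0, _)"]
      by (intro linearI) auto
    show "L (f, 0) \<le> c" if "0 \<le> c" "\<And>x. apply_bcontfun f x \<le> c" for f c
      using L(2)[of "(f, 0)"] le[OF S0[of c "(f, 0)"]] that by simp
    show "L (0, f) \<le> c" if "0 \<le> c" "\<And>x. apply_bcontfun f x \<le> c" for f c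
      using L(2)[of "(0, f)"] le[OF S0[of c "(0, f)"]] that by simp
    have *: "L (v, - v) \<le> 0" if "v \<in> V" for v
    proof -
      have "0 \<in> S (v, - v)"
        unfolding S_def using subspace_neg[OF V that] by (auto intro!: bexI[of _ "- v"])
      then show ?thesis using L(2)[of "(v, - v)"] le[of 0 "(v, - v)"] by simp
    qed
    show "L (v, 0) = L (0, v)" if "v \<in> V" for v
    proof -
      have "L (- v, v) = - L (v, - v)"
        using linear_neg[OF L(1), of "(v, - v)"] by simp
      then show ?thesis
        using *[OF that] *[OF subspace_neg[OF V that]] split[of v "- v"] neg[of v] by simp
    qed
    show "L (f0, 0) \<noteq> L (0, f0)"
      using pos L(3) split[of f0 "- f0"] neg[of f0] by simp
  qed
qed

section \<open>Functions vanishing at infinity\<close>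

lemma C0_I:
  fixes f :: "'a::metric_space \<Rightarrow> real"
  assumes f: "continuous_on \<Omega> f"
    and K: "\<And>e. 0 < e \<Longrightarrow> \<exists>K. compact K \<and> K \<subseteq> \<Omega> \<and> (\<forall>x\<in>\<Omega>. e \<le> \<bar>f x\<bar> \<longrightarrow> x \<in> K)"
  shows "f \<in> C0 \<Omega>"
proof -
  have "compact {x \<in> \<Omega>. e \<le> \<bar>f x\<bar>}" if e: "0 < e" for e
  proof -
    obtain K where K: "compact K" "K \<subseteq> \<Omega>" "\<forall>x\<in>\<Omega>. e \<le> \<bar>f x\<bar> \<longrightarrow> x \<in> K"
      using K[OF e] by blast
    have "continuous_on K (\<lambda>x. \<bar>f x\<bar>)"
      by (intro continuous_intros continuous_on_subset[OF f K(2)])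
    then have "closedin (top_of_set K) (K \<inter> (\<lambda>x. \<bar>f x\<bar>) -` {e..})"
      by (rule continuous_closedin_preimage) simp
    then have "compact (K \<inter> (\<lambda>x. \<bar>f x\<bar>) -` {e..})"
      by (rule closedin_compact[OF K(1)])
    also have "K \<inter> (\<lambda>x. \<bar>f x\<bar>) -` {e..} = {x \<in> \<Omega>. e \<le> \<bar>f x\<bar>}"
      using K(2,3) by auto
    finally show ?thesis .
  qed
  then show ?thesis using f by (simp add: C0_def)
qed

lemma C0_D:
  assumes "f \<in> C0 \<Omega>"
  shows "continuous_on \<Omega> f" and "0 < e \<Longrightarrow> compact {x \<in> \<Omega>. e \<le> \<bar>f x\<bar>}"
  using assms by (auto simp: C0_def)

lemma C0_dominated:
  fixes f g :: "'a::metric_space \<Rightarrow> real"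
  assumes f: "continuous_on \<Omega> f" and g: "g \<in> C0 \<Omega>" and C: "0 < C"
    and le: "\<And>x. x \<in> \<Omega> \<Longrightarrow> \<bar>f x\<bar> \<le> C * \<bar>g x\<bar>"
  shows "f \<in> C0 \<Omega>"
proof (rule C0_I[OF f])
  fix e :: real assume e: "0 < e"
  have "e / C \<le> \<bar>g x\<bar>" if "x \<in> \<Omega>" "e \<le> \<bar>f x\<bar>" for x
    using le[OF that(1)] that(2) C by (simp add: field_simps)
  then show "\<exists>K. compact K \<and> K \<subseteq> \<Omega> \<and> (\<forall>x\<in>\<Omega>. e \<le> \<bar>f x\<bar> \<longrightarrow> x \<in> K)"
    using C0_D(2)[OF g, of "e / C"] e C
    by (intro exI[of _ "{x \<in> \<Omega>. e / C \<le> \<bar>g x\<bar>}"]) auto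
qed

lemma C0_zero: "(\<lambda>x. 0) \<in> C0 \<Omega>"
  by (simp add: C0_def)

lemma C0_scale:
  fixes f :: "'a::metric_space \<Rightarrow> real"
  assumes f: "f \<in> C0 \<Omega>"
  shows "(\<lambda>x. c * f x) \<in> C0 \<Omega>"
proof (rule C0_dominated[OF _ f])
  show "continuous_on \<Omega> (\<lambda>x. c * f x)" by (intro continuous_intros C0_D(1)[OF f])
  show "0 < \<bar>c\<bar> + 1" by simp
  show "\<bar>c * f x\<bar> \<le> (\<bar>c\<bar> + 1) * \<bar>f x\<bar>" for x by (simp add: abs_mult algebra_simps)
qed

lemma C0_add:
  fixes f g :: "'a::metric_space \<Rightarrow> real"
  assumes f: "f \<in> C0 \<Omega>" and g: "g \<in> C0 \<Omega>"
  shows "(\<lambda>x. f x + g x) \<in> C0 \<Omega>"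
proof (rule C0_I)
  show "continuous_on \<Omega> (\<lambda>x. f x + g x)" by (intro continuous_intros C0_D(1)[OF f] C0_D(1)[OF g])
  fix e :: real assume e: "0 < e"
  show "\<exists>K. compact K \<and> K \<subseteq> \<Omega> \<and> (\<forall>x\<in>\<Omega>. e \<le> \<bar>f x + g x\<bar> \<longrightarrow> x \<in> K)"
    using C0_D(2)[OF f, of "e / 2"] C0_D(2)[OF g, of "e / 2"] e
    by (intro exI[of _ "{x \<in> \<Omega>. e / 2 \<le> \<bar>f x\<bar>} \<union> {x \<in> \<Omega>. e / 2 \<le> \<bar>g x\<bar>}"])
      (auto intro!: compact_Un)
qed

lemma C0_diff:
  fixes f g :: "'a::metric_space \<Rightarrow> real"
  assumes f: "f \<in> C0 \<Omega>" and g: "g \<in> C0 \<Omega>"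
  shows "(\<lambda>x. f x - g x) \<in> C0 \<Omega>"
  using C0_add[OF f C0_scale[OF g, of "-1"]] by simp

lemma C0_sum:
  fixes f :: "'i \<Rightarrow> 'a::metric_space \<Rightarrow> real"
  assumes "\<And>i. i \<in> S \<Longrightarrow> f i \<in> C0 \<Omega>"
  shows "(\<lambda>x. \<Sum>i\<in>S. f i x) \<in> C0 \<Omega>"
  using assms by (induction S rule: infinite_finite_induct) (auto intro: C0_zero C0_add)

lemma C0_mult:
  fixes f :: "'a::metric_space \<Rightarrow> real"
  assumes f: "f \<in> C0 \<Omega>" and g: "continuous_on \<Omega> g" "\<And>x. x \<in> \<Omega> \<Longrightarrow> \<bar>g x\<bar> \<le> 1"
  shows "(\<lambda>x. f x * g x) \<in> C0 \<Omega>"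
proof (rule C0_dominated[OF _ f, of _ 1])
  show "continuous_on \<Omega> (\<lambda>x. f x * g x)" by (intro continuous_intros C0_D(1)[OF f] g(1))
  show "\<bar>f x * g x\<bar> \<le> 1 * \<bar>f x\<bar>" if "x \<in> \<Omega>" for x
    using g(2)[OF that] by (simp add: abs_mult mult_left_le)
qed simp

lemma C0_bounded:
  fixes f :: "'a::metric_space \<Rightarrow> real"
  assumes f: "f \<in> C0 \<Omega>"
  shows "\<exists>B>0. \<forall>x\<in>\<Omega>. \<bar>f x\<bar> \<le> B"
proof -
  let ?K = "{x \<in> \<Omega>. 1 \<le> \<bar>f x\<bar>}"
  have "compact (f ` ?K)"
    using C0_D(2)[OF f, of 1] by (intro compact_continuous_image continuous_on_subset[OF C0_D(1)[OF f]]) auto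
  then obtain B where B: "\<forall>y\<in>f ` ?K. \<bar>y\<bar> \<le> B"
    using compact_imp_bounded by (fastforce simp: bounded_iff)
  have "\<bar>f x\<bar> \<le> max B 1" if "x \<in> \<Omega>" for x
    using B that by (cases "1 \<le> \<bar>f x\<bar>") auto
  then show ?thesis by (intro exI[of _ "max B 1"]) auto
qed

section \<open>The Riesz representation theorem for positive functionals\<close>

text \<open>A positive functional of norm at most one. The strictly positive function \<open>w\<close> is a form of
  \<open>\<sigma>\<close>-compactness: \<open>\<Omega>\<close> is exhausted by the compact sets \<open>{x \<in> \<Omega>. w x \<ge> 1 / n}\<close>.\<close>
locale positive_C0_functional =
  fixes \<Omega> :: "'a::metric_space set" and I :: "('a \<Rightarrow> real) \<Rightarrow> real" and w :: "'a \<Rightarrow> real"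
  assumes add: "f \<in> C0 \<Omega> \<Longrightarrow> g \<in> C0 \<Omega> \<Longrightarrow> I (\<lambda>x. f x + g x) = I f + I g"
    and scale: "f \<in> C0 \<Omega> \<Longrightarrow> I (\<lambda>x. c * f x) = c * I f"
    and le_const: "f \<in> C0 \<Omega> \<Longrightarrow> 0 \<le> c \<Longrightarrow> (\<And>x. x \<in> \<Omega> \<Longrightarrow> f x \<le> c) \<Longrightarrow> I f \<le> c"
    and w: "w \<in> C0 \<Omega>" and w_pos: "x \<in> \<Omega> \<Longrightarrow> 0 < w x"
begin

lemma diff: "f \<in> C0 \<Omega> \<Longrightarrow> g \<in> C0 \<Omega> \<Longrightarrow> I (\<lambda>x. f x - g x) = I f - I g"
  using add[of f "\<lambda>x. -1 * g x"] scale[of g "-1"] C0_scale[of g \<Omega> "-1"] by simp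

lemma zero: "I (\<lambda>x. 0) = 0"
  using scale[OF C0_zero, of 0] by simp

lemma mono_const:
  assumes "f \<in> C0 \<Omega>" "g \<in> C0 \<Omega>" "0 \<le> c" "\<And>x. x \<in> \<Omega> \<Longrightarrow> f x \<le> g x + c"
  shows "I f \<le> I g + c"
  using le_const[OF C0_diff[OF assms(1,2)] assms(3)] assms(4) diff[OF assms(1,2)]
  by (simp add: algebra_simps)

lemma mono:
  assumes "f \<in> C0 \<Omega>" "g \<in> C0 \<Omega>" "\<And>x. x \<in> \<Omega> \<Longrightarrow> f x \<le> g x"
  shows "I f \<le> I g"
  using mono_const[of f g 0] assms by simp

lemma nonneg: "f \<in> C0 \<Omega> \<Longrightarrow> (\<And>x. x \<in> \<Omega> \<Longrightarrow> 0 \<le> f x) \<Longrightarrow> 0 \<le> I f"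
  using mono[OF C0_zero, of f] zero by simp

lemma sum:
  assumes "\<And>i. i \<in> S \<Longrightarrow> f i \<in> C0 \<Omega>"
  shows "I (\<lambda>x. \<Sum>i\<in>S. f i x) = (\<Sum>i\<in>S. I (f i))"
  using assms by (induction S rule: infinite_finite_induct) (auto simp: zero add C0_sum)

text \<open>The representing measure is Daniell's: a set is covered by countably many nonnegative functions
  whose sum is at least one on it, and its outer measure is the cheapest total price \<open>I\<close> of a cover.
  Covers of different sets can be merged into one sequence, so countable subadditivity is immediate.\<close>
definition covers :: "'a set \<Rightarrow> (nat \<Rightarrow> 'a \<Rightarrow> real) set" where
  "covers A = {F. (\<forall>n. F n \<in> C0 \<Omega> \<and> (\<forall>x\<in>\<Omega>. 0 \<le> F n x)) \<and> (\<forall>x\<in>A. 1 \<le> (\<Sum>n. ennreal (F n x)))}"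

definition outer :: "'a set \<Rightarrow> ennreal" where
  "outer A = (INF F\<in>covers A. \<Sum>n. ennreal (I (F n)))"

lemma coversD:
  assumes "F \<in> covers A"
  shows "F n \<in> C0 \<Omega>" and "x \<in> \<Omega> \<Longrightarrow> 0 \<le> F n x" and "x \<in> A \<Longrightarrow> 1 \<le> (\<Sum>n. ennreal (F n x))"
  using assms by (auto simp: covers_def)

lemma outer_le: "F \<in> covers A \<Longrightarrow> outer A \<le> (\<Sum>n. ennreal (I (F n)))"
  unfolding outer_def by (rule INF_lower)

lemma outer_mono: "A \<subseteq> B \<Longrightarrow> outer A \<le> outer B"
  unfolding outer_def by (rule INF_superset_mono) (auto simp: covers_def)

lemma outer_empty: "outer {} = 0"
proof -
  have "(\<lambda>n x. 0) \<in> covers {}" by (auto simp: covers_def C0_zero)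
  from outer_le[OF this] show ?thesis by (simp add: zero)
qed

lemma outer_le_double:
  assumes F: "\<And>i j. F i j \<in> C0 \<Omega>" "\<And>i j x. x \<in> \<Omega> \<Longrightarrow> 0 \<le> F i j x"
    and A: "\<And>x. x \<in> A \<Longrightarrow> 1 \<le> (\<Sum>i. \<Sum>j. ennreal (F i j x))"
  shows "outer A \<le> (\<Sum>i. \<Sum>j. ennreal (I (F i j)))"
proof -
  define G where "G m = case_prod F (prod_decode m)" for m
  have "G \<in> covers A"
  proof -
    have "(\<Sum>m. ennreal (G m x)) = (\<Sum>i. \<Sum>j. ennreal (F i j x))" for x
      using suminf_ennreal_2dimen[of "\<lambda>i. \<Sum>j. ennreal (F i j x)" "\<lambda>(i, j). ennreal (F i j x)"]
      by (simp add: G_def case_prod_unfold)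
    then show ?thesis
      using F A by (auto simp: covers_def G_def split: prod.split)
  qed
  then have "outer A \<le> (\<Sum>m. ennreal (I (G m)))" by (rule outer_le)
  also have "\<dots> = (\<Sum>i. \<Sum>j. ennreal (I (F i j)))"
    using suminf_ennreal_2dimen[of "\<lambda>i. \<Sum>j. ennreal (I (F i j))" "\<lambda>(i, j). ennreal (I (F i j))"]
    by (simp add: G_def case_prod_unfold)
  finally show ?thesis .
qed

lemma outer_countably_subadditive: "outer (\<Union>i. A i) \<le> (\<Sum>i::nat. outer (A i))"
proof (rule ennreal_le_epsilon)
  fix e :: real assume e: "0 < e" and fin: "(\<Sum>i. outer (A i)) < top"
  have "\<exists>F\<in>covers (A i). (\<Sum>n. ennreal (I (F n))) \<le> outer (A i) + ennreal (e * (1/2) ^ Suc i)" for i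
  proof -
    have "outer (A i) < top"
      using fin by (auto simp: less_top dest!: ennreal_suminf_lessD)
    then have "outer (A i) < outer (A i) + ennreal (e * (1/2) ^ Suc i)"
      using e by (simp add: ennreal_add_left_cancel_less[of "outer (A i)" 0, simplified] less_top)
    then show ?thesis
      unfolding outer_def[of "A i"] INF_less_iff by (auto intro: less_imp_le)
  qed
  then obtain F where F: "\<And>i. F i \<in> covers (A i)"
    and le: "\<And>i. (\<Sum>n. ennreal (I (F i n))) \<le> outer (A i) + ennreal (e * (1/2) ^ Suc i)"
    by metis
  have "outer (\<Union>i. A i) \<le> (\<Sum>i. \<Sum>n. ennreal (I (F i n)))"
  proof (rule outer_le_double)
    show "F i j \<in> C0 \<Omega>" for i j by (rule coversD(1)[OF F])
    show "0 \<le> F i j x" if "x \<in> \<Omega>" for i j x by (rule coversD(2)[OF F that])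
    fix x assume "x \<in> (\<Union>i. A i)"
    then obtain i where "x \<in> A i" by blast
    then have "1 \<le> (\<Sum>n. ennreal (F i n x))" by (rule coversD(3)[OF F])
    also have "\<dots> \<le> (\<Sum>i. \<Sum>n. ennreal (F i n x))"
      using sum_le_suminf[of "\<lambda>i. \<Sum>n. ennreal (F i n x)" "{i}"] by simp
    finally show "1 \<le> (\<Sum>i. \<Sum>n. ennreal (F i n x))" .
  qed
  also have "\<dots> \<le> (\<Sum>i. outer (A i) + ennreal (e * (1/2) ^ Suc i))"
    by (intro suminf_le le summableI)
  also have "\<dots> = (\<Sum>i. outer (A i)) + (\<Sum>i. ennreal (e * (1/2) ^ Suc i))"
    by (intro suminf_add[symmetric] summableI)
  also have "(\<Sum>i. ennreal (e * (1/2) ^ Suc i)) = ennreal e"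
    using e sums_mult[OF power_half_series, of e] by (intro suminf_ennreal_eq) auto
  finally show "outer (\<Union>i. A i) \<le> (\<Sum>i. outer (A i)) + ennreal e" .
qed

lemma outer_measure_space_outer: "outer_measure_space (Pow \<Omega>) outer"
  by (auto simp: outer_measure_space_def positive_def increasing_def countably_subadditive_def
      outer_empty outer_mono outer_countably_subadditive)

text \<open>Caratheodory's criterion for a set \<open>G\<close> that is exhausted from inside by continuous functions
  \<open>\<phi> m\<close>. A cover \<open>F\<close> of \<open>A\<close> splits into \<open>F n * (\<phi> (j + 1) - \<phi> j)\<close>, which telescopes to a cover of
  \<open>A \<inter> G\<close>, and \<open>F n * (1 - \<phi> (m n))\<close>, which still covers \<open>A - G\<close> for whatever choice of \<open>m n\<close>. Taking
  \<open>m n\<close> large makes the two prices add up to that of \<open>F n\<close> up to an error summable in \<open>n\<close>.\<close>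
lemma outer_split:
  assumes A: "A \<subseteq> \<Omega>" and cont: "\<And>m. continuous_on \<Omega> (\<phi> m)"
    and \<phi>0: "\<And>x. \<phi> 0 x = 0" and inc: "\<And>m x. \<phi> m x \<le> \<phi> (Suc m) x" and \<phi>1: "\<And>m x. \<phi> m x \<le> 1"
    and out: "\<And>m x. x \<notin> G \<Longrightarrow> \<phi> m x = (0::real)"
    and lim: "\<And>x. x \<in> G \<Longrightarrow> (\<lambda>m. \<phi> m x) \<longlonglongrightarrow> 1"
  shows "outer (A \<inter> G) + outer (A - G) \<le> outer A"
  unfolding outer_def[of A]
proof (rule INF_greatest)
  fix F assume F: "F \<in> covers A"
  have ge0: "0 \<le> \<phi> m x" for m x
    using lift_Suc_mono_le[of "\<lambda>m. \<phi> m x", OF inc, of 0 m] by (simp add: \<phi>0)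
  note FC = coversD(1)[OF F] and F0 = coversD(2)[OF F]
  have F\<phi>: "(\<lambda>x. F n x * \<phi> m x) \<in> C0 \<Omega>" for n m
    by (rule C0_mult[OF FC cont]) (simp add: ge0 \<phi>1)
  define b where "b n m = I (\<lambda>x. F n x * \<phi> m x)" for n m
  have b_mono: "b n m \<le> b n (Suc m)" for n m
    unfolding b_def by (intro mono F\<phi>) (simp add: F0 inc mult_left_mono)
  have b_le: "b n m \<le> I (F n)" for n m
    unfolding b_def by (intro mono F\<phi> FC) (simp add: F0 \<phi>1 mult_left_le)
  \<comment> \<open>\<open>c n\<close> is the share of the price of \<open>F n\<close> that is spent inside \<open>G\<close>\<close>
  define c where "c n = lim (b n)" for n
  have b_lim: "b n \<longlonglongrightarrow> c n" for n
  proof -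
    have "convergent (b n)"
    proof (rule Bseq_mono_convergent)
      show "Bseq (b n)"
        using b_le[of n] nonneg[OF F\<phi>] F0 ge0
        by (intro BseqI'[of _ "I (F n)"]) (auto simp: b_def)
      show "\<forall>m k. m \<le> k \<longrightarrow> b n m \<le> b n k"
        using lift_Suc_mono_le[of "b n", OF b_mono] by blast
    qed
    then show ?thesis by (simp add: c_def convergent_LIMSEQ_iff)
  qed
  have b_c: "b n m \<le> c n" for n m
    by (rule incseq_le[OF _ b_lim]) (auto intro: incseq_SucI b_mono)
  have c_le: "c n \<le> I (F n)" for n
    by (rule LIMSEQ_le_const2[OF b_lim]) (use b_le in auto)
  have b0: "b n 0 = 0" for n by (simp add: b_def \<phi>0 zero)
  have c0: "0 \<le> c n" for n using b_c[of n 0] by (simp add: b0)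
  have inside: "outer (A \<inter> G) \<le> (\<Sum>n. ennreal (c n))"
  proof -
    have sums_c: "(\<Sum>j. ennreal (I (\<lambda>x. F n x * \<phi> (Suc j) x - F n x * \<phi> j x))) = ennreal (c n)" for n
    proof (rule suminf_ennreal_eq)
      have eq: "I (\<lambda>x. F n x * \<phi> (Suc j) x - F n x * \<phi> j x) = b n (Suc j) - b n j" for j
        unfolding b_def by (intro diff F\<phi>)
      show "0 \<le> I (\<lambda>x. F n x * \<phi> (Suc j) x - F n x * \<phi> j x)" for j
        by (simp add: eq b_mono)
      show "(\<lambda>j. I (\<lambda>x. F n x * \<phi> (Suc j) x - F n x * \<phi> j x)) sums c n"
        using telescope_sums[OF b_lim[of n]] by (simp add: eq b0)
    qed
    have "outer (A \<inter> G) \<le> (\<Sum>n. \<Sum>j. ennreal (I (\<lambda>x. F n x * \<phi> (Suc j) x - F n x * \<phi> j x)))"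
    proof (rule outer_le_double)
      show "(\<lambda>x. F n x * \<phi> (Suc j) x - F n x * \<phi> j x) \<in> C0 \<Omega>" for n j by (intro C0_diff F\<phi>)
      show 1: "0 \<le> F n x * \<phi> (Suc j) x - F n x * \<phi> j x" if "x \<in> \<Omega>" for n j x
        using F0[OF that] inc by (simp add: mult_left_mono)
      fix x assume x: "x \<in> A \<inter> G"
      have "(\<Sum>j. ennreal (F n x * \<phi> (Suc j) x - F n x * \<phi> j x)) = ennreal (F n x)" for n
      proof (rule suminf_ennreal_eq)
        show "0 \<le> F n x * \<phi> (Suc j) x - F n x * \<phi> j x" for j using x A 1 by blast
        have "(\<lambda>m. F n x * \<phi> m x) \<longlonglongrightarrow> F n x * 1"
          using x by (intro tendsto_intros lim) auto
        from telescope_sums[OF this]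
        show "(\<lambda>j. F n x * \<phi> (Suc j) x - F n x * \<phi> j x) sums F n x" by (simp add: \<phi>0)
      qed
      then show "1 \<le> (\<Sum>n. \<Sum>j. ennreal (F n x * \<phi> (Suc j) x - F n x * \<phi> j x))"
        using coversD(3)[OF F] x by simp
    qed
    then show ?thesis by (simp only: sums_c)
  qed
  show "outer (A \<inter> G) + outer (A - G) \<le> (\<Sum>n. ennreal (I (F n)))"
  proof (rule ennreal_le_epsilon)
    fix e :: real assume e: "0 < e"
    have "\<exists>m. c n - e * (1/2) ^ Suc n < b n m" for n
    proof -
      have "c n - e * (1/2) ^ Suc n < c n" using e by simp
      from order_tendstoD(1)[OF b_lim this] show ?thesis
        by (auto simp: eventually_sequentially)
    qed
    then obtain m where m: "\<And>n. c n - e * (1/2) ^ Suc n < b n (m n)" by metis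
    have C: "(\<lambda>x. F n x - F n x * \<phi> (m n) x) \<in> C0 \<Omega>" for n by (intro C0_diff F\<phi> FC)
    have "(\<lambda>n x. F n x - F n x * \<phi> (m n) x) \<in> covers (A - G)"
      using C F0 \<phi>1 coversD(3)[OF F] out by (auto simp: covers_def mult_left_le)
    then have "outer (A - G) \<le> (\<Sum>n. ennreal (I (\<lambda>x. F n x - F n x * \<phi> (m n) x)))"
      by (rule outer_le)
    also have "\<dots> \<le> (\<Sum>n. ennreal (I (F n) - c n + e * (1/2) ^ Suc n))"
    proof (intro suminf_le summableI ennreal_leI)
      fix n
      have "I (\<lambda>x. F n x - F n x * \<phi> (m n) x) = I (F n) - b n (m n)"
        unfolding b_def by (intro diff F\<phi> FC)
      then show "I (\<lambda>x. F n x - F n x * \<phi> (m n) x) \<le> I (F n) - c n + e * (1/2) ^ Suc n"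
        using m[of n] by simp
    qed
    finally have "outer (A \<inter> G) + outer (A - G) \<le>
        (\<Sum>n. ennreal (c n)) + (\<Sum>n. ennreal (I (F n) - c n + e * (1/2) ^ Suc n))"
      by (intro add_mono inside)
    also have "\<dots> = (\<Sum>n. ennreal (c n) + ennreal (I (F n) - c n + e * (1/2) ^ Suc n))"
      by (intro suminf_add summableI)
    also have "\<dots> = (\<Sum>n. ennreal (I (F n)) + ennreal (e * (1/2) ^ Suc n))"
      using c0 c_le nonneg[OF FC F0] e
      by (intro suminf_cong) (simp add: ennreal_plus[symmetric] del: ennreal_plus)
    also have "\<dots> = (\<Sum>n. ennreal (I (F n))) + (\<Sum>n. ennreal (e * (1/2) ^ Suc n))"
      by (intro suminf_add[symmetric] summableI)
    also have "(\<Sum>n. ennreal (e * (1/2) ^ Suc n)) = ennreal e"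
      using e sums_mult[OF power_half_series, of e] by (intro suminf_ennreal_eq) auto
    finally show "outer (A \<inter> G) + outer (A - G) \<le> (\<Sum>n. ennreal (I (F n))) + ennreal e" .
  qed
qed

definition riesz_measure :: "'a measure" where
  "riesz_measure = measure_of \<Omega> (sets (restrict_space borel \<Omega>)) outer"

lemma open_Int_in_lambda_system:
  assumes G: "open G"
  shows "\<Omega> \<inter> G \<in> lambda_system \<Omega> (Pow \<Omega>) outer"
proof -
  have le: "outer (A \<inter> G) + outer (A - G) \<le> outer A" if A: "A \<subseteq> \<Omega>" for A
  proof (cases "G = UNIV")
    case True
    then show ?thesis by (simp add: outer_empty)
  next
    case False
    \<comment> \<open>increases with \<open>m\<close> to the indicator of \<open>G\<close>\<close>
    define \<phi> where "\<phi> m x = min 1 (real m * infdist x (- G))" for m x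
    show ?thesis
    proof (rule outer_split[OF A, of \<phi>])
      show "continuous_on \<Omega> (\<phi> m)" for m
        unfolding \<phi>_def by (intro continuous_intros)
      show "\<phi> m x \<le> \<phi> (Suc m) x" for m x
        unfolding \<phi>_def by (intro min.mono order_refl mult_right_mono infdist_nonneg) simp
      show "(\<lambda>m. \<phi> m x) \<longlonglongrightarrow> 1" if x: "x \<in> G" for x
      proof -
        have "infdist x (- G) \<noteq> 0"
          using in_closed_iff_infdist_zero[of "- G" x] G False x by auto
        then have d: "0 < infdist x (- G)" using infdist_nonneg[of x "- G"] by simp
        obtain N :: nat where N: "1 / infdist x (- G) < N" using reals_Archimedean2 by blast
        have "\<phi> m x = 1" if "N \<le> m" for m
        proof -
          have "1 / infdist x (- G) \<le> real m" using N that by simp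
          then show ?thesis using d by (simp add: \<phi>_def field_simps)
        qed
        then show ?thesis
          by (intro tendsto_eventually) (auto simp: eventually_sequentially)
      qed
    qed (auto simp: \<phi>_def)
  qed
  have "outer (\<Omega> \<inter> G \<inter> A) + outer ((\<Omega> - \<Omega> \<inter> G) \<inter> A) = outer A" if A: "A \<subseteq> \<Omega>" for A
  proof (rule antisym)
    have *: "\<Omega> \<inter> G \<inter> A = A \<inter> G" "(\<Omega> - \<Omega> \<inter> G) \<inter> A = A - G" using A by auto
    show "outer (\<Omega> \<inter> G \<inter> A) + outer ((\<Omega> - \<Omega> \<inter> G) \<inter> A) \<le> outer A"
      unfolding * by (rule le[OF A])
    have "subadditive (Pow \<Omega>) outer"
    proof -
      interpret sigma_algebra \<Omega> "Pow \<Omega>" by (rule sigma_algebra_Pow)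
      show ?thesis using outer_measure_space_outer
        by (intro countably_subadditive_subadditive) (auto simp: outer_measure_space_def)
    qed
    from subadditiveD[OF this, of "A \<inter> G" "A - G"] A
    have "outer (A \<inter> G \<union> (A - G)) \<le> outer (A \<inter> G) + outer (A - G)" by auto
    moreover have "A \<inter> G \<union> (A - G) = A" by auto
    ultimately show "outer A \<le> outer (\<Omega> \<inter> G \<inter> A) + outer ((\<Omega> - \<Omega> \<inter> G) \<inter> A)"
      unfolding * by simp
  qed
  then show ?thesis by (auto simp: lambda_system_def)
qed

lemma measure_space_lambda_system:
  "measure_space \<Omega> (lambda_system \<Omega> (Pow \<Omega>) outer) outer"
proof -
  interpret sigma_algebra \<Omega> "Pow \<Omega>" by (rule sigma_algebra_Pow)
  show ?thesis by (rule caratheodory_lemma[OF outer_measure_space_outer])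
qed

lemma borel_subset_lambda_system:
  "sets (restrict_space borel \<Omega>) \<subseteq> lambda_system \<Omega> (Pow \<Omega>) outer"
proof -
  let ?L = "lambda_system \<Omega> (Pow \<Omega>) outer"
  interpret sigma_algebra \<Omega> ?L using measure_space_lambda_system by (simp add: measure_space_def)
  have "\<Omega> \<inter> B \<in> ?L" if "B \<in> sigma_sets UNIV {S. open S}" for B
    using that
  proof induction
    case (Compl B)
    have "\<Omega> \<inter> (UNIV - B) = \<Omega> - \<Omega> \<inter> B" by auto
    then show ?case using compl_sets[OF Compl.IH] by simp
  next
    case (Union B)
    then have "(\<Union>i. \<Omega> \<inter> B i) \<in> ?L" by (intro countable_nat_UN) auto
    then show ?case by (simp only: Int_UN_distrib)
  qed (auto simp: open_Int_in_lambda_system)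
  moreover have "sets (borel :: 'a measure) = sigma_sets UNIV {S. open S}"
    by (simp add: borel_def)
  ultimately show ?thesis
    unfolding sets_restrict_space by blast
qed

lemma space_riesz: "space riesz_measure = \<Omega>"
  and sets_riesz [measurable_cong]: "sets riesz_measure = sets (restrict_space borel \<Omega>)"
proof -
  have sub: "sets (restrict_space borel \<Omega>) \<subseteq> Pow \<Omega>"
    by (auto simp: sets_restrict_space)
  have sig: "sigma_sets \<Omega> (sets (restrict_space borel \<Omega>)) = sets (restrict_space borel \<Omega>)"
    using sets.sigma_sets_eq[of "restrict_space borel \<Omega>"]
    unfolding space_restrict_space space_borel Int_UNIV_right .
  show "space riesz_measure = \<Omega>"
    unfolding riesz_measure_def by (rule space_measure_of[OF sub])
  show "sets riesz_measure = sets (restrict_space borel \<Omega>)"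
    unfolding riesz_measure_def sets_measure_of[OF sub] by (rule sig)
qed

lemma emeasure_riesz:
  assumes "A \<in> sets (restrict_space borel \<Omega>)"
  shows "emeasure riesz_measure A = outer A"
proof (rule emeasure_measure_of[OF riesz_measure_def])
  show "sets (restrict_space borel \<Omega>) \<subseteq> Pow \<Omega>"
    by (auto simp: sets_restrict_space)
  show "positive (sets riesz_measure) outer" by (simp add: positive_def outer_empty)
  show "countably_additive (sets riesz_measure) outer"
  proof (rule countably_additiveI)
    fix A :: "nat \<Rightarrow> 'a set"
    assume A: "range A \<subseteq> sets riesz_measure" "disjoint_family A" "(\<Union>i. A i) \<in> sets riesz_measure"
    have "countably_additive (lambda_system \<Omega> (Pow \<Omega>) outer) outer"
      using measure_space_lambda_system by (simp add: measure_space_def)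
    moreover have "range A \<subseteq> lambda_system \<Omega> (Pow \<Omega>) outer"
      using A(1) borel_subset_lambda_system unfolding sets_riesz by (rule order_trans)
    moreover have "(\<Union>i. A i) \<in> lambda_system \<Omega> (Pow \<Omega>) outer"
      using A(3) borel_subset_lambda_system unfolding sets_riesz by (rule subsetD[rotated])
    ultimately show "(\<Sum>i. outer (A i)) = outer (\<Union>i. A i)"
      using A(2) unfolding countably_additive_def by simp
  qed
  show "A \<in> sets riesz_measure" unfolding sets_riesz by (rule assms)
qed

lemma space_in_sets: "\<Omega> \<in> sets (restrict_space borel \<Omega>)"
  using sets.top[of "restrict_space borel \<Omega>"]
  unfolding space_restrict_space space_borel Int_UNIV_right .

lemma C0_measurable: "f \<in> C0 \<Omega> \<Longrightarrow> f \<in> borel_measurable riesz_measure"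
  using borel_measurable_continuous_on_restrict[OF C0_D(1), of f \<Omega>]
  unfolding measurable_cong_sets[OF sets_riesz refl] .

definition cutoff :: "nat \<Rightarrow> 'a \<Rightarrow> real" where "cutoff n x = min 1 (real n * w x)"

lemma cutoff: "cutoff n \<in> C0 \<Omega>" and cutoff_bounds: "x \<in> \<Omega> \<Longrightarrow> 0 \<le> cutoff n x" "cutoff n x \<le> 1"
  and cutoff_mono: "x \<in> \<Omega> \<Longrightarrow> cutoff n x \<le> cutoff (Suc n) x" and cutoff_0: "x \<in> \<Omega> \<Longrightarrow> cutoff 0 x = 0"
  and cutoff_lim: "x \<in> \<Omega> \<Longrightarrow> (\<lambda>n. cutoff n x) \<longlonglongrightarrow> 1"
proof -
  show b: "0 \<le> cutoff n x" if "x \<in> \<Omega>" for x using w_pos[OF that] by (simp add: cutoff_def)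
  show "cutoff n x \<le> 1" for x by (simp add: cutoff_def)
  show "cutoff n \<in> C0 \<Omega>"
  proof (rule C0_dominated[OF _ w, of _ "real n + 1"])
    show "continuous_on \<Omega> (cutoff n)" unfolding cutoff_def by (intro continuous_intros C0_D(1)[OF w])
    show "\<bar>cutoff n x\<bar> \<le> (real n + 1) * \<bar>w x\<bar>" if "x \<in> \<Omega>" for x
      using b[OF that] w_pos[OF that] by (simp add: algebra_simps) (simp add: cutoff_def)
  qed simp
  show "cutoff n x \<le> cutoff (Suc n) x" if "x \<in> \<Omega>"
    unfolding cutoff_def by (intro min.mono order_refl mult_right_mono) (use w_pos[OF that] in auto)
  show "cutoff 0 x = 0" by (simp add: cutoff_def)
  show "(\<lambda>n. cutoff n x) \<longlonglongrightarrow> 1" if "x \<in> \<Omega>"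
  proof -
    obtain N :: nat where N: "1 / w x < N" using reals_Archimedean2 by blast
    have "cutoff m x = 1" if m: "N \<le> m" for m
    proof -
      have "1 / w x \<le> real m" using N m by simp
      then show ?thesis using w_pos[OF \<open>x \<in> \<Omega>\<close>] by (simp add: cutoff_def field_simps)
    qed
    then show ?thesis by (intro tendsto_eventually) (auto simp: eventually_sequentially)
  qed
qed

text \<open>The increments of \<open>cutoff\<close> cover \<open>\<Omega>\<close>, and their total price is the limit of \<open>I (cutoff n)\<close>. This
  bounds the mass of the measure by the norm of the functional.\<close>
lemma outer_space_le:
  obtains s where "(\<lambda>n. I (cutoff n)) \<longlonglongrightarrow> s" and "outer \<Omega> \<le> ennreal s"
proof -
  have conv: "convergent (\<lambda>n. I (cutoff n))"
  proof (rule Bseq_mono_convergent)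
    have "0 \<le> I (cutoff n)" "I (cutoff n) \<le> 1" for n
      using nonneg[OF cutoff cutoff_bounds(1)] le_const[OF cutoff, of 1] cutoff_bounds(2) by auto
    then show "Bseq (\<lambda>n. I (cutoff n))" by (intro BseqI'[of _ 1]) auto
    have "I (cutoff n) \<le> I (cutoff (Suc n))" for n by (intro mono cutoff cutoff_mono)
    then show "\<forall>m n. m \<le> n \<longrightarrow> I (cutoff m) \<le> I (cutoff n)" using lift_Suc_mono_le[of "\<lambda>n. I (cutoff n)"] by blast
  qed
  then obtain s where s: "(\<lambda>n. I (cutoff n)) \<longlonglongrightarrow> s" by (auto simp: convergent_def)
  have eq: "I (\<lambda>x. cutoff (Suc n) x - cutoff n x) = I (cutoff (Suc n)) - I (cutoff n)" for n by (intro diff cutoff)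
  have I0: "I (cutoff 0) = 0"
  proof -
    have "cutoff 0 = (\<lambda>x. 0)" by (simp add: cutoff_def fun_eq_iff)
    then show ?thesis by (simp add: zero)
  qed
  have "(\<lambda>n x. cutoff (Suc n) x - cutoff n x) \<in> covers \<Omega>"
    unfolding covers_def
  proof (intro CollectI conjI allI ballI)
    show "(\<lambda>x. cutoff (Suc n) x - cutoff n x) \<in> C0 \<Omega>" for n by (intro C0_diff cutoff)
    show *: "0 \<le> cutoff (Suc n) x - cutoff n x" if "x \<in> \<Omega>" for n x using cutoff_mono[OF that] by simp
    show "1 \<le> (\<Sum>n. ennreal (cutoff (Suc n) x - cutoff n x))" if x: "x \<in> \<Omega>" for x
    proof -
      have "(\<Sum>n. ennreal (cutoff (Suc n) x - cutoff n x)) = ennreal 1"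
        using telescope_sums[OF cutoff_lim[OF x]] cutoff_0[OF x] by (intro suminf_ennreal_eq *[OF x]) auto
      then show ?thesis by simp
    qed
  qed
  then have "outer \<Omega> \<le> (\<Sum>n. ennreal (I (\<lambda>x. cutoff (Suc n) x - cutoff n x)))"
    by (rule outer_le)
  also have "\<dots> = ennreal s"
    using telescope_sums[OF s] by (intro suminf_ennreal_eq) (auto simp: eq I0 intro: mono cutoff cutoff_mono)
  finally show thesis by (rule that[OF s])
qed

lemma finite_riesz: "finite_measure riesz_measure"
proof
  obtain s where "outer \<Omega> \<le> ennreal s" using outer_space_le by blast
  then show "emeasure riesz_measure (space riesz_measure) \<noteq> \<infinity>"
    by (auto simp: space_riesz emeasure_riesz space_in_sets top_unique)
qed

text \<open>Functions below the indicator of \<open>B\<close> cost at most the outer measure of \<open>B\<close>. For a cover \<open>F\<close> the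
  partial sums exceed \<open>h - e\<close> from some point on, by Dini's argument: the increasing open sets where
  they do so cover the compact set \<open>{h \<ge> e}\<close>, and off that set there is nothing to show.\<close>
lemma le_outer:
  assumes h: "h \<in> C0 \<Omega>" "\<And>x. x \<in> \<Omega> \<Longrightarrow> 0 \<le> h x" "\<And>x. x \<in> \<Omega> \<Longrightarrow> h x \<le> 1"
    and B: "\<And>x. x \<in> \<Omega> \<Longrightarrow> 0 < h x \<Longrightarrow> x \<in> B"
  shows "ennreal (I h) \<le> outer B"
  unfolding outer_def
proof (rule INF_greatest)
  fix F assume F: "F \<in> covers B"
  note FC = coversD(1)[OF F] and F0 = coversD(2)[OF F]
  show "ennreal (I h) \<le> (\<Sum>n. ennreal (I (F n)))"
  proof (rule ennreal_le_epsilon)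
    fix e :: real assume e: "0 < e"
    let ?K = "{x \<in> \<Omega>. e \<le> \<bar>h x\<bar>}"
    have K: "compact ?K" by (rule C0_D(2)[OF h(1) e])
    define s where "s N x = (\<Sum>n<N. F n x)" for N x
    have sC: "s N \<in> C0 \<Omega>" for N unfolding s_def by (intro C0_sum FC)
    have s_mono: "s M x \<le> s N x" if "M \<le> N" "x \<in> \<Omega>" for M N x
      unfolding s_def using that by (intro sum_mono2) (auto simp: F0)
    define U where "U N = {x \<in> \<Omega>. h x - e < s N x}" for N
    have U_open: "openin (top_of_set \<Omega>) (U N)" for N
    proof -
      have "openin (top_of_set \<Omega>) (\<Omega> \<inter> (\<lambda>x. s N x - h x) -` {-e<..})"
        by (intro continuous_openin_preimage_gen continuous_intros C0_D(1)[OF sC] C0_D(1)[OF h(1)])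
      moreover have "\<Omega> \<inter> (\<lambda>x. s N x - h x) -` {-e<..} = U N" by (auto simp: U_def)
      ultimately show ?thesis by simp
    qed
    have cover: "?K \<subseteq> (\<Union>N. U N)"
    proof
      fix x assume "x \<in> ?K"
      then have x: "x \<in> \<Omega>" "x \<in> B" using B[of x] h(2)[of x] e by auto
      have "ennreal (1 - e) < (\<Sum>n. ennreal (F n x))"
      proof -
        have "ennreal (1 - e) < 1" using e by (simp add: ennreal_less_one_iff)
        also have "1 \<le> (\<Sum>n. ennreal (F n x))" by (rule coversD(3)[OF F x(2)])
        finally show ?thesis .
      qed
      moreover have "(\<lambda>N. ennreal (s N x)) \<longlonglongrightarrow> (\<Sum>n. ennreal (F n x))"
        using summable_LIMSEQ[OF summableI, of "\<lambda>n. ennreal (F n x)"] F0[OF x(1)]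
        by (simp add: s_def sum_ennreal)
      ultimately obtain N where N: "ennreal (1 - e) < ennreal (s N x)"
        using order_tendstoD(1) by (fastforce simp: eventually_sequentially)
      then have "1 - e < s N x" by (cases "0 \<le> 1 - e") (auto simp: ennreal_less_iff ennreal_neg)
      then have "x \<in> U N" using x h(3)[OF x(1)] by (simp add: U_def)
      then show "x \<in> (\<Union>N. U N)" by blast
    qed
    have "\<exists>N. ?K \<subseteq> U N"
    proof -
      have "\<forall>N. \<exists>T. open T \<and> U N = T \<inter> \<Omega>"
        using U_open by (metis openin_open Int_commute)
      then obtain T where T: "\<And>N. open (T N)" "\<And>N. U N = T N \<inter> \<Omega>" by metis
      have KT: "?K \<subseteq> (\<Union>N\<in>UNIV. T N)" using cover unfolding T(2) by blast
      obtain D where D: "finite D" "?K \<subseteq> (\<Union>N\<in>D. T N)"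
        by (rule compactE_image[OF K _ KT]) (auto intro: T(1))
      have "?K \<subseteq> U (Max (insert 0 D))"
      proof
        fix x assume x: "x \<in> ?K"
        then obtain N where N: "N \<in> D" "x \<in> U N" using D T(2) by auto
        have "s N x \<le> s (Max (insert 0 D)) x"
          using D(1) N(1) x by (intro s_mono) auto
        then show "x \<in> U (Max (insert 0 D))" using N(2) by (simp add: U_def)
      qed
      then show ?thesis by blast
    qed
    then obtain N where N: "?K \<subseteq> U N" by blast
    have "h x \<le> s N x + e" if x: "x \<in> \<Omega>" for x
    proof (cases "x \<in> ?K")
      case True then show ?thesis using N by (auto simp: U_def)
    next
      case False
      then show ?thesis using x s_mono[of 0 N x] by (auto simp: s_def)
    qed
    then have "I h \<le> I (s N) + e" using e by (intro mono_const h(1) sC) auto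
    also have "I (s N) = (\<Sum>n<N. I (F n))" unfolding s_def by (rule sum[OF FC])
    finally have "ennreal (I h) \<le> ennreal ((\<Sum>n<N. I (F n)) + e)" by (rule ennreal_leI)
    also have "\<dots> = (\<Sum>n<N. ennreal (I (F n))) + ennreal e"
      using nonneg[OF FC F0] e by (simp add: sum_ennreal sum_nonneg)
    also have "\<dots> \<le> (\<Sum>n. ennreal (I (F n))) + ennreal e"
      by (intro add_mono order_refl sum_le_suminf summableI) auto
    finally show "ennreal (I h) \<le> (\<Sum>n. ennreal (I (F n))) + ennreal e" .
  qed
qed

sublocale riesz: finite_measure riesz_measure
  by (rule finite_riesz)

lemma C0_integrable:
  assumes f: "f \<in> C0 \<Omega>"
  shows "integrable riesz_measure f"
proof -
  obtain B where "\<forall>x\<in>\<Omega>. \<bar>f x\<bar> \<le> B" using C0_bounded[OF f] by blast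
  then show ?thesis
    by (intro riesz.integrable_const_bound[of _ B] C0_measurable[OF f] AE_I2) (auto simp: space_riesz)
qed

lemma C0_min:
  assumes f: "f \<in> C0 \<Omega>" "\<And>x. x \<in> \<Omega> \<Longrightarrow> 0 \<le> f x" and "0 \<le> c"
  shows "(\<lambda>x. min (f x) c) \<in> C0 \<Omega>"
proof (rule C0_dominated[OF _ f(1), of _ 1])
  show "continuous_on \<Omega> (\<lambda>x. min (f x) c)" by (intro continuous_intros C0_D(1)[OF f(1)])
  show "\<bar>min (f x) c\<bar> \<le> 1 * \<bar>f x\<bar>" if "x \<in> \<Omega>" for x using f(2)[OF that] \<open>0 \<le> c\<close> by auto
qed simp

text \<open>Layer cake: \<open>f\<close> is cut into slices \<open>min f ((j + 1) e) - min f (j e)\<close> of height \<open>e\<close>. The slice of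
  index \<open>j\<close> is \<open>e\<close> times a function below the indicator of \<open>{f > j e}\<close>, and the step function
  given by \<open>e\<close> times the sum of these indicators exceeds \<open>f\<close> by at most \<open>e\<close>.\<close>
lemma le_integral:
  assumes f: "f \<in> C0 \<Omega>" "\<And>x. x \<in> \<Omega> \<Longrightarrow> 0 \<le> f x"
  shows "I f \<le> integral\<^sup>L riesz_measure f"
proof (rule field_le_epsilon)
  fix d :: real assume d: "0 < d"
  define m where "m = measure riesz_measure \<Omega>"
  \<comment> \<open>the summand 1 keeps \<open>e\<close> positive when the mass \<open>m\<close> is zero\<close>
  define e where "e = d / (m + 1)"
  have m0: "0 \<le> m" by (simp add: m_def)
  have e: "0 < e" using d m0 by (simp add: e_def)
  define t where "t j x = min (f x) (real j * e)" for j x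
  define l where "l j = {x \<in> \<Omega>. real j * e < f x}" for j
  have tC: "t j \<in> C0 \<Omega>" for j
    unfolding t_def using e by (intro C0_min f) auto
  have l_sets: "l j \<in> sets riesz_measure" for j
    using measurable_sets[OF C0_measurable[OF f(1)], of "{real j * e<..}"]
    by (auto simp: l_def space_riesz vimage_def Int_def conj_commute)
  have l_int: "integrable riesz_measure (\<lambda>x. e * indicator (l j) x)" for j
    by (intro integrable_mult_right integrable_real_indicator l_sets)
      (simp add: riesz.emeasure_eq_measure)
  obtain B where B: "\<forall>x\<in>\<Omega>. \<bar>f x\<bar> \<le> B" using C0_bounded[OF f(1)] by blast
  obtain N :: nat where N: "B / e < N" using reals_Archimedean2 by blast
  have tN: "t N x = f x" if "x \<in> \<Omega>" for x
    using B[rule_format, OF that] N e by (auto simp: t_def field_simps)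
  have layer: "I (t (Suc j)) - I (t j) \<le> e * measure riesz_measure (l j)" for j
  proof -
    have dC: "(\<lambda>x. t (Suc j) x - t j x) \<in> C0 \<Omega>" by (intro C0_diff tC)
    have "ennreal (I (\<lambda>x. (1 / e) * (t (Suc j) x - t j x))) \<le> outer (l j)"
    proof (rule le_outer[OF C0_scale[OF dC]])
      fix x assume x: "x \<in> \<Omega>"
      show "0 \<le> 1 / e * (t (Suc j) x - t j x)" using e by (auto simp: t_def field_simps)
      show "1 / e * (t (Suc j) x - t j x) \<le> 1" using e by (auto simp: t_def field_simps min_def)
      show "x \<in> l j" if "0 < 1 / e * (t (Suc j) x - t j x)"
        using that e x by (auto simp: t_def l_def field_simps min_def split: if_splits)
    qed
    also have "outer (l j) = ennreal (measure riesz_measure (l j))"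
      using emeasure_riesz[of "l j"] l_sets[of j] by (simp add: riesz.emeasure_eq_measure sets_riesz)
    also have "I (\<lambda>x. (1 / e) * (t (Suc j) x - t j x)) = (1 / e) * (I (t (Suc j)) - I (t j))"
      unfolding scale[OF dC] diff[OF tC tC] ..
    finally have "(1 / e) * (I (t (Suc j)) - I (t j)) \<le> measure riesz_measure (l j)"
      by (simp add: ennreal_le_iff)
    then show ?thesis using e by (simp add: field_simps)
  qed
  have "I (t 0) = 0"
  proof -
    have "I (t 0) \<le> 0" "0 \<le> I (t 0)"
      using le_const[OF tC, of 0 0] nonneg[OF tC, of 0] f(2) by (auto simp: t_def)
    then show ?thesis by simp
  qed
  then have "I (t N) = (\<Sum>j<N. I (t (Suc j)) - I (t j))"
    using sum_lessThan_telescope[of "\<lambda>j. I (t j)" N] by simp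
  also have "\<dots> \<le> (\<Sum>j<N. e * measure riesz_measure (l j))" by (intro sum_mono layer)
  also have "\<dots> = (\<integral>x. (\<Sum>j<N. e * indicator (l j) x) \<partial>riesz_measure)"
    unfolding Bochner_Integration.integral_sum[OF l_int] using l_sets
    by (simp add: sets.Int_space_eq2)
  also have "\<dots> \<le> (\<integral>x. f x + e \<partial>riesz_measure)"
  proof (rule integral_mono)
    show "integrable riesz_measure (\<lambda>x. \<Sum>j<N. e * indicator (l j) x)"
      by (intro Bochner_Integration.integrable_sum l_int)
    show "integrable riesz_measure (\<lambda>x. f x + e)" using C0_integrable[OF f(1)] by simp
    fix x assume "x \<in> space riesz_measure"
    then have x: "x \<in> \<Omega>" by (simp add: space_riesz)
    have "(\<Sum>j<n. e * indicator (l j) x) \<le> min (f x) (real n * e) + e" for n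
    proof (induction n)
      case 0 then show ?case using f(2)[OF x] e by simp
    next
      case (Suc n)
      show ?case
      proof (cases "real n * e < f x")
        case True
        have "(\<Sum>j<n. e * indicator (l j) x) \<le> (\<Sum>j<n. e)"
          using e by (intro sum_mono) (auto simp: indicator_def)
        also have "\<dots> \<le> min (f x) (real (Suc n) * e)"
          using True e by (auto simp: algebra_simps)
        moreover have "e * indicator (l n) x = e" using True x by (simp add: l_def)
        ultimately show ?thesis unfolding sum.lessThan_Suc by linarith
      next
        case False
        then have "e * indicator (l n) x = 0" by (simp add: l_def)
        moreover have "min (f x) (real n * e) \<le> min (f x) (real (Suc n) * e)"
          using e by (intro min.mono order_refl mult_right_mono) auto
        ultimately show ?thesis unfolding sum.lessThan_Suc using Suc by linarith
      qed
    qed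
    from this[of N] show "(\<Sum>j<N. e * indicator (l j) x) \<le> f x + e" by linarith
  qed
  also have "\<dots> = integral\<^sup>L riesz_measure f + e * m"
    using C0_integrable[OF f(1)] by (simp add: m_def space_riesz)
  also have "e * m \<le> d" using d m0 by (simp add: e_def field_simps)
  finally have "I (t N) \<le> integral\<^sup>L riesz_measure f + d" by simp
  moreover have "I f \<le> I (t N)" by (intro mono f(1) tC) (simp add: tN)
  ultimately show "I f \<le> integral\<^sup>L riesz_measure f + d" by simp
qed

text \<open>The reverse inequality comes from the previous one applied to \<open>v - f\<close>, where \<open>v\<close> lies between
  \<open>B * cutoff n\<close> and the constant bound \<open>B\<close> of \<open>f\<close>: on such \<open>v\<close> the integral exceeds the
  functional by at most \<open>B\<close> times the distance of \<open>I (cutoff n)\<close> from its limit, which is at least the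
  total mass.\<close>
lemma integral_nonneg_eq:
  assumes f: "f \<in> C0 \<Omega>" "\<And>x. x \<in> \<Omega> \<Longrightarrow> 0 \<le> f x"
  shows "integral\<^sup>L riesz_measure f = I f"
proof (rule antisym[OF _ le_integral[OF f]])
  obtain B where B: "0 < B" "\<forall>x\<in>\<Omega>. \<bar>f x\<bar> \<le> B" using C0_bounded[OF f(1)] by blast
  obtain s where s: "(\<lambda>n. I (cutoff n)) \<longlonglongrightarrow> s" "outer \<Omega> \<le> ennreal s" by (rule outer_space_le)
  have s0: "0 \<le> s"
    by (rule LIMSEQ_le_const[OF s(1)]) (auto intro: nonneg cutoff cutoff_bounds)
  have ms: "measure riesz_measure \<Omega> \<le> s"
    using s(2) unfolding emeasure_riesz[OF space_in_sets, symmetric] riesz.emeasure_eq_measure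
    by (simp add: ennreal_le_iff[OF s0])
  have "integral\<^sup>L riesz_measure f \<le> B * s - B * I (cutoff n) + I f" for n
  proof -
    define v where "v x = max (B * cutoff n x) (f x)" for x
    have vC: "v \<in> C0 \<Omega>"
    proof (rule C0_dominated[OF _ C0_add[OF C0_scale[OF cutoff, of B n] f(1)], of _ 1])
      show "continuous_on \<Omega> v"
        unfolding v_def by (intro continuous_intros C0_D(1)[OF cutoff] C0_D(1)[OF f(1)])
      show "\<bar>v x\<bar> \<le> 1 * \<bar>B * cutoff n x + f x\<bar>" if "x \<in> \<Omega>" for x
        using f(2)[OF that] mult_nonneg_nonneg[OF less_imp_le[OF B(1)] cutoff_bounds(1)[OF that, of n]]
        by (auto simp: v_def)
    qed simp
    have "I v - I f = I (\<lambda>x. v x - f x)" by (rule diff[OF vC f(1), symmetric])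
    also have "\<dots> \<le> (\<integral>x. v x - f x \<partial>riesz_measure)"
      by (rule le_integral[OF C0_diff[OF vC f(1)]]) (simp add: v_def)
    also have "\<dots> = integral\<^sup>L riesz_measure v - integral\<^sup>L riesz_measure f"
      using C0_integrable[OF vC] C0_integrable[OF f(1)] by simp
    finally have "I v - I f \<le> integral\<^sup>L riesz_measure v - integral\<^sup>L riesz_measure f" .
    moreover have "integral\<^sup>L riesz_measure v \<le> B * s"
    proof -
      have "integral\<^sup>L riesz_measure v \<le> (\<integral>x. B \<partial>riesz_measure)"
      proof (rule integral_mono)
        fix x assume "x \<in> space riesz_measure"
        then show "v x \<le> B"
          using B cutoff_bounds(2)[of n x] by (auto simp: v_def space_riesz abs_le_iff)
      qed (simp_all add: C0_integrable[OF vC])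
      also have "\<dots> = B * measure riesz_measure \<Omega>" by (simp add: space_riesz)
      also have "\<dots> \<le> B * s" using ms B(1) by simp
      finally show ?thesis .
    qed
    moreover have "B * I (cutoff n) \<le> I v"
      unfolding scale[OF cutoff, symmetric] by (intro mono C0_scale cutoff vC) (simp add: v_def)
    ultimately show ?thesis by linarith
  qed
  moreover have "(\<lambda>n. B * s - B * I (cutoff n) + I f) \<longlonglongrightarrow> B * s - B * s + I f"
    by (intro tendsto_intros s(1))
  ultimately have "integral\<^sup>L riesz_measure f \<le> B * s - B * s + I f"
    by (intro LIMSEQ_le_const) auto
  then show "integral\<^sup>L riesz_measure f \<le> I f" by simp
qed

theorem integral_riesz:
  assumes f: "f \<in> C0 \<Omega>"
  shows "integral\<^sup>L riesz_measure f = I f"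
proof -
  have cont: "continuous_on \<Omega> (\<lambda>x. max 0 (f x))" "continuous_on \<Omega> (\<lambda>x. max 0 (- f x))"
    by (intro continuous_intros C0_D(1)[OF f])+
  have p: "(\<lambda>x. max 0 (f x)) \<in> C0 \<Omega>" by (rule C0_dominated[OF cont(1) f, of 1]) auto
  have n: "(\<lambda>x. max 0 (- f x)) \<in> C0 \<Omega>" by (rule C0_dominated[OF cont(2) f, of 1]) auto
  have eq: "f = (\<lambda>x. max 0 (f x) - max 0 (- f x))" by (auto simp: fun_eq_iff)
  have "integral\<^sup>L riesz_measure f =
      (\<integral>x. max 0 (f x) \<partial>riesz_measure) - (\<integral>x. max 0 (- f x) \<partial>riesz_measure)"
    by (subst eq) (rule Bochner_Integration.integral_diff[OF C0_integrable[OF p] C0_integrable[OF n]])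
  also have "\<dots> = I (\<lambda>x. max 0 (f x)) - I (\<lambda>x. max 0 (- f x))"
    by (simp add: integral_nonneg_eq[OF p] integral_nonneg_eq[OF n])
  also have "\<dots> = I f"
    by (subst (3) eq) (rule diff[OF p n, symmetric])
  finally show ?thesis .
qed

end

section \<open>Integration with respect to a signed measure\<close>

lemma signed_integral_cong:
  assumes "\<And>x. x \<in> space M \<Longrightarrow> f x = g x"
  shows "signed_integral M \<mu> f = signed_integral M \<mu> g"
proof -
  have "space (pos_part M \<nu>) = space M" for \<nu>
    unfolding pos_part_def by (rule space_measure_of[OF sets.space_closed])
  then show ?thesis
    unfolding signed_integral_def
    by (intro arg_cong2[of _ _ _ _ "(-)"] Bochner_Integration.integral_cong refl) (simp_all add: assms)
qed

text \<open>With a density \<open>h\<close> at hand the supremum over subsets of \<open>A\<close> is attained at \<open>A \<inter> {h > 0}\<close>, so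
  the Jordan decomposition is the decomposition of \<open>h\<close> into its positive and negative part.\<close>
lemma pos_part_density:
  fixes h :: "'b \<Rightarrow> real"
  assumes sets: "sets N = sets M" and h: "integrable N h"
    and \<mu>: "\<And>A. A \<in> sets M \<Longrightarrow> \<mu> A = (\<integral>x. indicator A x * h x \<partial>N)"
  shows "pos_part M \<mu> = density N (\<lambda>x. ennreal (h x))"
proof -
  have [measurable]: "h \<in> borel_measurable N" using h by simp
  note [measurable_cong] = sets
  have int: "integrable N (\<lambda>x. indicator B x * g x)" if "B \<in> sets M" "integrable N g" for B and g :: "'b \<Rightarrow> real"
    using integrable_mult_indicator[of B N g] that sets by simp
  have mint: "integrable N (\<lambda>x. max 0 (h x))" using h by simp
  have "(SUP B\<in>{B\<in>sets M. B \<subseteq> A}. ennreal (\<mu> B)) = emeasure (density N (\<lambda>x. ennreal (h x))) A"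
    if A: "A \<in> sets M" for A
  proof -
    have AN: "A \<in> sets N" using A sets by simp
    let ?v = "\<integral>x. indicator A x * max 0 (h x) \<partial>N"
    have "emeasure (density N (\<lambda>x. ennreal (h x))) A = (\<integral>\<^sup>+x. ennreal (h x) * indicator A x \<partial>N)"
      using AN by (rule emeasure_density[rotated]) simp
    also have "\<dots> = (\<integral>\<^sup>+x. ennreal (indicator A x * max 0 (h x)) \<partial>N)"
      by (intro nn_integral_cong) (auto simp: indicator_def max_def ennreal_neg)
    also have "\<dots> = ennreal ?v"
      by (rule nn_integral_eq_integral[OF int[OF A mint]]) simp
    finally have eq: "emeasure (density N (\<lambda>x. ennreal (h x))) A = ennreal ?v" .
    show ?thesis unfolding eq
    proof (rule antisym)
      show "(SUP B\<in>{B\<in>sets M. B \<subseteq> A}. ennreal (\<mu> B)) \<le> ennreal ?v"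
      proof (rule SUP_least)
        fix B assume "B \<in> {B\<in>sets M. B \<subseteq> A}"
        then have B: "B \<in> sets M" "B \<subseteq> A" by auto
        have "\<mu> B \<le> ?v"
          unfolding \<mu>[OF B(1)]
          by (rule integral_mono[OF int[OF B(1) h] int[OF A mint]]) (use B(2) in \<open>auto simp: indicator_def\<close>)
        then show "ennreal (\<mu> B) \<le> ennreal ?v" by (rule ennreal_leI)
      qed
      let ?B = "A \<inter> {x \<in> space N. 0 < h x}"
      have "{x \<in> space N. 0 < h x} \<in> sets N" by measurable
      then have B: "?B \<in> sets M" using A sets by auto
      have "?v = \<mu> ?B"
        unfolding \<mu>[OF B] by (intro Bochner_Integration.integral_cong) (auto simp: indicator_def max_def)
      then show "ennreal ?v \<le> (SUP B\<in>{B\<in>sets M. B \<subseteq> A}. ennreal (\<mu> B))"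
        using B by (intro SUP_upper2[of ?B]) auto
    qed
  qed
  then have "pos_part M \<mu> = measure_of (space M) (sets M) (emeasure (density N (\<lambda>x. ennreal (h x))))"
    unfolding pos_part_def by (intro measure_of_eq sets.space_closed) (simp add: sets.sigma_sets_eq)
  also have "\<dots> = density N (\<lambda>x. ennreal (h x))"
    using measure_of_of_measure[of "density N (\<lambda>x. ennreal (h x))"] sets sets_eq_imp_space_eq[OF sets] by simp
  finally show ?thesis .
qed

lemma signed_integral_density:
  fixes h f :: "'b \<Rightarrow> real"
  assumes sets: "sets N = sets M" and h: "integrable N h"
    and \<mu>: "\<And>A. A \<in> sets M \<Longrightarrow> \<mu> A = (\<integral>x. indicator A x * h x \<partial>N)"
    and f: "f \<in> borel_measurable M" "\<And>x. x \<in> space M \<Longrightarrow> \<bar>f x\<bar> \<le> C"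
  shows "signed_integral M \<mu> f = (\<integral>x. h x * f x \<partial>N)"
proof -
  have sp: "space N = space M" using sets by (rule sets_eq_imp_space_eq)
  have fN: "f \<in> borel_measurable N" using f(1) by (simp add: measurable_cong_sets[OF sets refl])
  have part: "(\<integral>x. f x \<partial>density N (\<lambda>x. ennreal (g x))) = (\<integral>x. max 0 (g x) * f x \<partial>N)"
    and fint: "integrable N (\<lambda>x. max 0 (g x) * f x)"
    if g: "integrable N g" for g :: "'b \<Rightarrow> real"
  proof -
    have "density N (\<lambda>x. ennreal (g x)) = density N (\<lambda>x. ennreal (max 0 (g x)))"
      by (intro arg_cong[of _ _ "density N"]) (auto simp: max_def ennreal_neg fun_eq_iff)
    moreover have "(\<integral>x. f x \<partial>density N (\<lambda>x. ennreal (max 0 (g x)))) = (\<integral>x. max 0 (g x) *\<^sub>R f x \<partial>N)"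
      using g fN by (intro integral_density) auto
    ultimately show "(\<integral>x. f x \<partial>density N (\<lambda>x. ennreal (g x))) = (\<integral>x. max 0 (g x) * f x \<partial>N)" by simp
    show "integrable N (\<lambda>x. max 0 (g x) * f x)"
    proof (rule Bochner_Integration.integrable_bound)
      show "integrable N (\<lambda>x. C * max 0 (g x))" using g by simp
      show "AE x in N. norm (max 0 (g x) * f x) \<le> norm (C * max 0 (g x))"
      proof (rule AE_I2)
        fix x assume "x \<in> space N"
        then have "\<bar>f x\<bar> \<le> \<bar>C\<bar>" using f(2)[of x] sp by auto
        then show "norm (max 0 (g x) * f x) \<le> norm (C * max 0 (g x))"
          by (simp add: abs_mult mult.commute mult_right_mono)
      qed
    qed (use g fN in simp)
  qed
  have neg: "- \<mu> A = (\<integral>x. indicator A x * - h x \<partial>N)" if "A \<in> sets M" for A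
    using \<mu>[OF that] by simp
  have mh: "integrable N (\<lambda>x. - h x)" using h by simp
  have "signed_integral M \<mu> f = (\<integral>x. max 0 (h x) * f x \<partial>N) - (\<integral>x. max 0 (- h x) * f x \<partial>N)"
  proof -
    have "pos_part M \<mu> = density N (\<lambda>x. ennreal (h x))"
      by (rule pos_part_density[OF sets h \<mu>])
    moreover have "pos_part M (\<lambda>A. - \<mu> A) = density N (\<lambda>x. ennreal (- h x))"
      by (rule pos_part_density[OF sets mh neg])
    ultimately show ?thesis
      by (simp only: signed_integral_def part[OF h] part[OF mh])
  qed
  also have "\<dots> = (\<integral>x. max 0 (h x) * f x - max 0 (- h x) * f x \<partial>N)"
    by (rule Bochner_Integration.integral_diff[OF fint[OF h] fint[OF mh], symmetric])
  also have "\<dots> = (\<integral>x. h x * f x \<partial>N)"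
    by (intro Bochner_Integration.integral_cong) (auto simp: max_def)
  finally show ?thesis .
qed

lemma common_dominating_measure:
  assumes M1: "finite_measure M1" and M2: "finite_measure M2" and sets: "sets M2 = sets M1"
  obtains N where "finite_measure N" "sets N = sets M1"
    "\<And>A. A \<in> sets M1 \<Longrightarrow> emeasure N A = emeasure M1 A + emeasure M2 A"
proof -
  define N where "N = measure_of (space M1) (sets M1) (\<lambda>A. emeasure M1 A + emeasure M2 A)"
  have em: "emeasure N A = emeasure M1 A + emeasure M2 A" if "A \<in> sets M1" for A
    unfolding N_def
  proof (rule emeasure_measure_of_sigma[OF sets.sigma_algebra_axioms _ _ that])
    show "positive (sets M1) (\<lambda>A. emeasure M1 A + emeasure M2 A)" by (simp add: positive_def)
    show "countably_additive (sets M1) (\<lambda>A. emeasure M1 A + emeasure M2 A)"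
    proof (rule countably_additiveI)
      fix A :: "nat \<Rightarrow> 'a set"
      assume A: "range A \<subseteq> sets M1" "disjoint_family A" "(\<Union>i. A i) \<in> sets M1"
      have "(\<Sum>i. emeasure M1 (A i) + emeasure M2 (A i)) = (\<Sum>i. emeasure M1 (A i)) + (\<Sum>i. emeasure M2 (A i))"
        by (intro suminf_add[symmetric] summableI)
      then show "(\<Sum>i. emeasure M1 (A i) + emeasure M2 (A i)) = emeasure M1 (\<Union>i. A i) + emeasure M2 (\<Union>i. A i)"
        using A sets by (simp add: suminf_emeasure)
    qed
  qed
  have sN: "sets N = sets M1" by (simp add: N_def)
  have "finite_measure N"
  proof
    have "space N = space M1" "space M2 = space M1" using sN sets by (auto dest: sets_eq_imp_space_eq)
    then show "emeasure N (space N) \<noteq> \<infinity>"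
      using em[of "space M1"] finite_measure.emeasure_finite[OF M1, of "space M1"]
        finite_measure.emeasure_finite[OF M2, of "space M1"] by simp
  qed
  then show thesis using sN em by (rule that)
qed

lemma finite_measure_real_density:
  assumes N: "finite_measure N" and M: "finite_measure M" and sets: "sets M = sets N"
    and le: "\<And>A. A \<in> sets N \<Longrightarrow> emeasure M A \<le> emeasure N A"
  obtains h where "integrable N h" "\<And>x. 0 \<le> h x" "M = density N (\<lambda>x. ennreal (h x))"
proof -
  interpret N: finite_measure N by (rule N)
  interpret M: finite_measure M by (rule M)
  have ac: "absolutely_continuous N M"
    unfolding absolutely_continuous_def
  proof
    fix A assume "A \<in> null_sets N"
    then show "A \<in> null_sets M" using le[of A] sets by (auto simp: null_sets_def)
  qed
  obtain D where D: "D \<in> borel_measurable N" "AE x in N. RN_deriv N M x = ennreal (D x)"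
    "\<And>x. 0 \<le> D x"
    using N.real_RN_deriv[OF M ac sets] by metis
  have "M = density N (RN_deriv N M)" by (rule N.density_RN_deriv[OF ac sets, symmetric])
  also have "\<dots> = density N (\<lambda>x. ennreal (D x))"
    by (rule density_cong) (use D in auto)
  finally have eq: "M = density N (\<lambda>x. ennreal (D x))" .
  have "integrable N D"
  proof (rule integrableI_nonneg[OF D(1)])
    have "(\<integral>\<^sup>+x. ennreal (D x) \<partial>N) = emeasure M (space N)"
      using D(1) by (subst eq) (simp add: emeasure_density cong: nn_integral_cong)
    then show "(\<integral>\<^sup>+x. ennreal (D x) \<partial>N) < \<infinity>" by (simp add: less_top[symmetric])
  qed (use D in auto)
  then show thesis using D(3) eq by (rule that)
qed

text \<open>The measures \<open>M1\<close> and \<open>M2\<close> need not be mutually singular, so they are in general larger than the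
  Jordan parts of their difference. Densities with respect to \<open>M1 + M2\<close> show that the excess
  cancels.\<close>
lemma signed_integral_diff_measure:
  fixes f :: "'b \<Rightarrow> real"
  assumes M1: "finite_measure M1" and M2: "finite_measure M2"
    and sets1: "sets M1 = sets M" and sets2: "sets M2 = sets M"
    and \<mu>: "\<And>A. A \<in> sets M \<Longrightarrow> \<mu> A = measure M1 A - measure M2 A"
    and f: "f \<in> borel_measurable M" "\<And>x. x \<in> space M \<Longrightarrow> \<bar>f x\<bar> \<le> C"
  shows "signed_integral M \<mu> f = (\<integral>x. f x \<partial>M1) - (\<integral>x. f x \<partial>M2)"
proof -
  obtain N where N: "finite_measure N" "sets N = sets M1"
    and em: "\<And>A. A \<in> sets M1 \<Longrightarrow> emeasure N A = emeasure M1 A + emeasure M2 A"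
    using common_dominating_measure[OF M1 M2] sets1 sets2 by metis
  have sN: "sets N = sets M" using N(2) sets1 by simp
  obtain h1 where h1: "integrable N h1" "\<And>x. 0 \<le> h1 x" "M1 = density N (\<lambda>x. ennreal (h1 x))"
    using finite_measure_real_density[OF N(1) M1] N(2) em by (metis le_iff_add)
  obtain h2 where h2: "integrable N h2" "\<And>x. 0 \<le> h2 x" "M2 = density N (\<lambda>x. ennreal (h2 x))"
  proof (rule finite_measure_real_density[OF N(1) M2])
    show "sets M2 = sets N" using sets2 sN by simp
    show "emeasure M2 A \<le> emeasure N A" if "A \<in> sets N" for A
      using em[of A] that N(2) by simp
  qed (use that in blast)
  have fN: "g \<in> borel_measurable N" if "g \<in> borel_measurable M" for g :: "'b \<Rightarrow> real"
    using that by (simp add: measurable_cong_sets[OF sN refl])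
  have int: "(\<integral>x. g x \<partial>M1) = (\<integral>x. h1 x * g x \<partial>N)" "(\<integral>x. g x \<partial>M2) = (\<integral>x. h2 x * g x \<partial>N)"
    if "g \<in> borel_measurable M" for g :: "'b \<Rightarrow> real"
    unfolding h1(3) h2(3)
    using integral_density[OF fN[OF that] borel_measurable_integrable[OF h1(1)]] h1(2)
      integral_density[OF fN[OF that] borel_measurable_integrable[OF h2(1)]] h2(2) by auto
  have hint: "integrable N (\<lambda>x. h x * g x)"
    if h: "integrable N h" and g: "g \<in> borel_measurable M" "\<And>x. x \<in> space M \<Longrightarrow> \<bar>g x\<bar> \<le> D"
    for h g :: "'b \<Rightarrow> real" and D
  proof (rule Bochner_Integration.integrable_bound)
    show "integrable N (\<lambda>x. D * h x)" using h by simp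
    show "AE x in N. norm (h x * g x) \<le> norm (D * h x)"
    proof (rule AE_I2)
      fix x assume "x \<in> space N"
      then have "\<bar>g x\<bar> \<le> \<bar>D\<bar>" using g(2)[of x] sets_eq_imp_space_eq[OF sN] by auto
      then show "norm (h x * g x) \<le> norm (D * h x)"
        by (simp add: abs_mult mult.commute mult_right_mono)
    qed
  qed (use h fN[OF g(1)] in simp)
  have "signed_integral M \<mu> f = (\<integral>x. (h1 x - h2 x) * f x \<partial>N)"
  proof (rule signed_integral_density[OF sN _ _ f])
    show "integrable N (\<lambda>x. h1 x - h2 x)" using h1(1) h2(1) by simp
    fix A assume A: "A \<in> sets M"
    have ind: "indicator A \<in> borel_measurable M" using A by simp
    have "measure M1 A = (\<integral>x. indicator A x \<partial>M1)" "measure M2 A = (\<integral>x. indicator A x \<partial>M2)"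
      using A sets1 sets2 by (simp_all add: sets.Int_space_eq2)
    then have "\<mu> A = (\<integral>x. h1 x * indicator A x \<partial>N) - (\<integral>x. h2 x * indicator A x \<partial>N)"
      using \<mu>[OF A] int[OF ind] by simp
    also have "\<dots> = (\<integral>x. h1 x * indicator A x - h2 x * indicator A x \<partial>N)"
      by (rule Bochner_Integration.integral_diff[symmetric]; rule hint[OF _ ind, of _ 1])
        (use h1(1) h2(1) in \<open>auto simp: indicator_def\<close>)
    also have "\<dots> = (\<integral>x. indicator A x * (h1 x - h2 x) \<partial>N)"
      by (simp add: algebra_simps)
    finally show "\<mu> A = (\<integral>x. indicator A x * (h1 x - h2 x) \<partial>N)" .
  qed
  also have "\<dots> = (\<integral>x. h1 x * f x \<partial>N) - (\<integral>x. h2 x * f x \<partial>N)"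
    unfolding left_diff_distrib
    by (rule Bochner_Integration.integral_diff[OF hint[OF h1(1) f] hint[OF h2(1) f]])
  finally show ?thesis using int[OF f(1)] by simp
qed

section \<open>Uniform density of the kernel sections\<close>

text \<open>A locally compact subset of a Euclidean space is \<open>T \<inter> closure \<Omega>\<close> with \<open>T\<close> open. The product of
  the distance to the complement of \<open>T\<close> and a weight decaying at infinity is positive on \<open>\<Omega>\<close>, and
  its superlevel sets stay away both from the boundary of \<open>T\<close> and from infinity.\<close>
lemma locally_compact_positive_C0:
  fixes \<Omega> :: "'a::euclidean_space set"
  assumes "locally compact \<Omega>"
  shows "\<exists>w\<in>C0 \<Omega>. \<forall>x\<in>\<Omega>. 0 < w x"
proof -
  obtain T where T: "open T" "\<Omega> = T \<inter> closure \<Omega>"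
    using locally_compact_open_Int_closure[OF assms] by blast
  \<comment> \<open>\<open>infdist x {} = 0\<close>, so \<open>T = UNIV\<close> has to be treated apart\<close>
  define d where "d x = (if T = UNIV then 1 else min 1 (infdist x (- T)))" for x
  have d_cont: "continuous_on S d" for S
    unfolding d_def by (cases "T = UNIV") (auto intro!: continuous_intros)
  have d_le: "d x \<le> 1" and d_ge: "0 \<le> d x" for x by (auto simp: d_def infdist_nonneg)
  have d_pos: "0 < d x \<longleftrightarrow> x \<in> T" for x
  proof (cases "T = UNIV")
    case False
    then have "infdist x (- T) = 0 \<longleftrightarrow> x \<in> - T"
      using T(1) by (intro in_closed_iff_infdist_zero[symmetric]) auto
    then show ?thesis using False infdist_nonneg[of x "- T"] by (auto simp: d_def)
  qed (simp add: d_def)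
  define w where "w x = d x / (1 + norm x)" for x
  have w_cont: "continuous_on S w" for S
    unfolding w_def by (intro continuous_intros d_cont) (smt (verit) norm_ge_zero)
  have w_ge: "0 \<le> w x" for x by (simp add: w_def d_ge)
  have "w \<in> C0 \<Omega>"
  proof (rule C0_I[OF w_cont])
    fix e :: real assume e: "0 < e"
    let ?K = "closure \<Omega> \<inter> w -` {e..}"
    have "closed ?K" by (rule continuous_closed_preimage[OF w_cont]) auto
    moreover have "bounded ?K"
      unfolding bounded_iff
    proof (intro exI ballI)
      fix x assume "x \<in> ?K"
      then have "e * (1 + norm x) \<le> d x"
        using divide_le_eq[of _ "1 + norm x"] pos_le_divide_eq[of "1 + norm x" e "d x"] norm_ge_zero[of x]
        by (simp add: w_def)
      then have "e * norm x \<le> 1" using d_le[of x] e by (simp add: algebra_simps)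
      then show "norm x \<le> 1 / e" using e by (simp add: field_simps)
    qed
    ultimately have "compact ?K" by (simp add: compact_eq_bounded_closed)
    moreover have "?K \<subseteq> \<Omega>"
    proof
      fix x assume x: "x \<in> ?K"
      then have "0 < d x" using e d_ge[of x] by (cases "d x = 0") (auto simp: w_def)
      then show "x \<in> \<Omega>" using x T(2) d_pos by blast
    qed
    moreover have "\<forall>x\<in>\<Omega>. e \<le> \<bar>w x\<bar> \<longrightarrow> x \<in> ?K"
      using w_ge closure_subset[of \<Omega>] by auto
    ultimately show "\<exists>K. compact K \<and> K \<subseteq> \<Omega> \<and> (\<forall>x\<in>\<Omega>. e \<le> \<bar>w x\<bar> \<longrightarrow> x \<in> K)" by blast
  qed
  moreover have "0 < w x" if "x \<in> \<Omega>" for x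
  proof -
    have "x \<in> T" using that T(2) by blast
    moreover have "0 < 1 + norm x" by (smt (verit) norm_ge_zero)
    ultimately show ?thesis using d_pos[of x] by (simp add: w_def)
  qed
  ultimately show ?thesis by blast
qed

lemma diff_measure_in_Mb:
  assumes M1: "finite_measure M1" and M2: "finite_measure M2"
    and sets1: "sets M1 = sets (restrict_space borel \<Omega>)" and sets2: "sets M2 = sets (restrict_space borel \<Omega>)"
  shows "(\<lambda>A. if A \<in> sets (restrict_space borel \<Omega>) then measure M1 A - measure M2 A else 0) \<in> Mb \<Omega>"
proof -
  interpret M1: finite_measure M1 by (rule M1)
  interpret M2: finite_measure M2 by (rule M2)
  let ?M = "restrict_space borel \<Omega>"
  let ?\<mu> = "\<lambda>A. if A \<in> sets ?M then measure M1 A - measure M2 A else 0"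
  have "(\<lambda>i. ?\<mu> (A i)) sums ?\<mu> (\<Union>i. A i)" if A: "range A \<subseteq> sets ?M" "disjoint_family A" for A :: "nat \<Rightarrow> _"
  proof -
    have "(\<Union>i. A i) \<in> sets ?M" using A(1) by (rule sets.countable_UN)
    moreover have "A i \<in> sets ?M" for i using A(1) by blast
    moreover have "(\<lambda>i. measure M1 (A i) - measure M2 (A i)) sums (measure M1 (\<Union>i. A i) - measure M2 (\<Union>i. A i))"
      using A sets1 sets2
      by (intro sums_diff M1.finite_measure_UNION M2.finite_measure_UNION) simp_all
    ultimately show ?thesis by simp
  qed
  then show ?thesis by (auto simp: Mb_def signed_measures_def)
qed

text \<open>Extension by zero destroys continuity at the boundary of \<open>\<Omega>\<close>. Over the discrete topology every
  bounded function is continuous, which makes \<open>C0 \<Omega>\<close> a subspace of a Banach space of bounded functions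
  with the supremum norm.\<close>
definition restrict_bcontfun :: "'a set \<Rightarrow> ('a \<Rightarrow> real) \<Rightarrow> 'a discrete \<Rightarrow>\<^sub>C real" where
  "restrict_bcontfun \<Omega> f = Bcontfun (\<lambda>z. if of_discrete z \<in> \<Omega> then f (of_discrete z) else 0)"

lemma apply_restrict_bcontfun:
  fixes f :: "'a::metric_space \<Rightarrow> real"
  assumes "f \<in> C0 \<Omega>"
  shows "apply_bcontfun (restrict_bcontfun \<Omega> f) z = (if of_discrete z \<in> \<Omega> then f (of_discrete z) else 0)"
proof -
  obtain B where B: "B > 0" "\<forall>x\<in>\<Omega>. \<bar>f x\<bar> \<le> B" using C0_bounded[OF assms] by blast
  have "(\<lambda>z. if of_discrete z \<in> \<Omega> then f (of_discrete z) else 0) \<in> bcontfun"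
  proof (rule bcontfun_normI[of _ B])
    show "continuous_on UNIV (\<lambda>z. if of_discrete z \<in> \<Omega> then f (of_discrete z) else 0)"
      by (simp add: continuous_on_open_vimage open_discrete)
  qed (use B in auto)
  then show ?thesis unfolding restrict_bcontfun_def by (simp add: Bcontfun_inverse)
qed

text \<open>If \<open>f\<close> were not a uniform limit of linear combinations of sections of the kernel, two positive
  functionals would agree on all sections but differ at \<open>f\<close>. The difference \<open>\<nu>\<close> of their representing
  measures is a nonzero element of \<open>Mb \<Omega>\<close> with \<open>\<integral> k x y d\<nu>(x) = 0\<close> for every \<open>y\<close>, by the symmetry of
  \<open>k\<close>, so the double integral in the hypothesis on \<open>k\<close> vanishes, a contradiction.\<close>
theorem kernel_sections_dense_in_C0:
  fixes \<Omega> :: "'a::euclidean_space set"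
  assumes "locally compact \<Omega>" and "positive_definite_kernel \<Omega> k" and H: "rkhs \<Omega> k H ip"
    and kC: "\<And>x. x \<in> \<Omega> \<Longrightarrow> k x \<in> C0 \<Omega>"
    and pos: "\<And>\<mu>. \<mu> \<in> Mb \<Omega> - {\<lambda>_. 0} \<Longrightarrow>
           signed_integral (restrict_space borel \<Omega>) \<mu>
             (\<lambda>y. signed_integral (restrict_space borel \<Omega>) \<mu> (\<lambda>x. k x y)) > 0"
    and f: "f \<in> C0 \<Omega>" and e: "0 < e"
  shows "\<exists>g\<in>H \<inter> C0 \<Omega>. \<forall>x\<in>\<Omega>. \<bar>f x - g x\<bar> \<le> e"
proof -
  interpret rkhs \<Omega> k H ip by (rule H)
  let ?E = "restrict_bcontfun \<Omega>"
  note E = apply_restrict_bcontfun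
  define V where "V = span ((\<lambda>x. ?E (k x)) ` \<Omega>)"
  have "?E f \<in> closure V"
  proof (rule ccontr)
    assume "?E f \<notin> closure V"
    with subspace_span obtain L1 L2 where L: "linear L1" "linear L2"
      and le1: "\<And>f c. 0 \<le> c \<Longrightarrow> (\<And>x. apply_bcontfun f x \<le> c) \<Longrightarrow> L1 f \<le> c"
      and le2: "\<And>f c. 0 \<le> c \<Longrightarrow> (\<And>x. apply_bcontfun f x \<le> c) \<Longrightarrow> L2 f \<le> c"
      and eq: "\<And>v. v \<in> V \<Longrightarrow> L1 v = L2 v" and ne: "L1 (?E f) \<noteq> L2 (?E f)"
      unfolding V_def by (rule separating_positive_functionals) blast
    obtain w where w: "w \<in> C0 \<Omega>" "\<And>x. x \<in> \<Omega> \<Longrightarrow> 0 < w x"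
      using locally_compact_positive_C0[OF assms(1)] by blast
    have functional: "positive_C0_functional \<Omega> (\<lambda>g. L (?E g)) w"
      if L: "linear L" and le: "\<And>f c. 0 \<le> c \<Longrightarrow> (\<And>x. apply_bcontfun f x \<le> c) \<Longrightarrow> L f \<le> c" for L
    proof
      fix g h assume gh: "g \<in> C0 \<Omega>" "h \<in> C0 \<Omega>"
      have "?E (\<lambda>x. g x + h x) = ?E g + ?E h"
        by (rule bcontfun_eqI) (simp add: E C0_add gh)
      then show "L (?E (\<lambda>x. g x + h x)) = L (?E g) + L (?E h)" by (simp add: linear_add[OF L])
    next
      fix g c assume g: "g \<in> C0 \<Omega>"
      have "?E (\<lambda>x. c * g x) = c *\<^sub>R ?E g"
        by (rule bcontfun_eqI) (simp add: E C0_scale g)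
      then show "L (?E (\<lambda>x. c * g x)) = c * L (?E g)" by (simp add: linear_scale[OF L])
    next
      fix g c assume "g \<in> C0 \<Omega>" "0 \<le> c" "\<And>x. x \<in> \<Omega> \<Longrightarrow> g x \<le> c"
      then show "L (?E g) \<le> c" by (intro le) (simp_all add: E)
    qed (rule w)+
    interpret F1: positive_C0_functional \<Omega> "\<lambda>g. L1 (?E g)" w by (rule functional[OF L(1) le1])
    interpret F2: positive_C0_functional \<Omega> "\<lambda>g. L2 (?E g)" w by (rule functional[OF L(2) le2])
    let ?M = "restrict_space borel \<Omega>"
    let ?M1 = "F1.riesz_measure" and ?M2 = "F2.riesz_measure"
    define \<nu> where "\<nu> A = (if A \<in> sets ?M then measure ?M1 A - measure ?M2 A else 0)" for A
    have sp: "space ?M = \<Omega>" by (simp add: space_restrict_space)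
    have int: "signed_integral ?M \<nu> g = L1 (?E g) - L2 (?E g)" if g: "g \<in> C0 \<Omega>" for g
    proof -
      obtain B where B: "\<forall>x\<in>\<Omega>. \<bar>g x\<bar> \<le> B" using C0_bounded[OF g] by blast
      have "signed_integral ?M \<nu> g = integral\<^sup>L ?M1 g - integral\<^sup>L ?M2 g"
      proof (rule signed_integral_diff_measure[OF F1.finite_riesz F2.finite_riesz F1.sets_riesz F2.sets_riesz])
        show "g \<in> borel_measurable ?M"
          by (rule borel_measurable_continuous_on_restrict[OF C0_D(1)[OF g]])
        show "\<bar>g x\<bar> \<le> B" if "x \<in> space ?M" for x using B that sp by auto
      qed (simp add: \<nu>_def)
      then show ?thesis by (simp add: F1.integral_riesz[OF g] F2.integral_riesz[OF g])
    qed
    have "\<nu> \<noteq> (\<lambda>_. 0)"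
    proof
      assume z: "\<nu> = (\<lambda>_. 0)"
      have "?M1 = ?M2"
      proof (rule measure_eqI)
        show "sets ?M1 = sets ?M2" by (simp only: F1.sets_riesz F2.sets_riesz)
        fix A assume "A \<in> sets ?M1"
        then have "measure ?M1 A = measure ?M2 A"
          using fun_cong[OF z, of A] by (simp add: \<nu>_def F1.sets_riesz)
        then show "emeasure ?M1 A = emeasure ?M2 A"
          by (simp add: F1.riesz.emeasure_eq_measure F2.riesz.emeasure_eq_measure)
      qed
      then show False using ne F1.integral_riesz[OF f] F2.integral_riesz[OF f] by simp
    qed
    moreover have "\<nu> \<in> Mb \<Omega>"
      using diff_measure_in_Mb[OF F1.finite_riesz F2.finite_riesz F1.sets_riesz F2.sets_riesz]
      by (simp only: \<nu>_def[abs_def])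
    ultimately have "0 < signed_integral ?M \<nu> (\<lambda>y. signed_integral ?M \<nu> (\<lambda>x. k x y))"
      by (intro pos) simp
    also have "\<dots> = signed_integral ?M \<nu> (\<lambda>y. 0)"
    proof (rule signed_integral_cong)
      fix y assume "y \<in> space ?M"
      then have y: "y \<in> \<Omega>" by (simp add: sp)
      have "signed_integral ?M \<nu> (\<lambda>x. k x y) = signed_integral ?M \<nu> (k y)"
        using assms(2) y by (intro signed_integral_cong) (simp add: positive_definite_kernel_def sp)
      also have "\<dots> = 0"
        using eq[of "?E (k y)"] y by (simp add: int[OF kC[OF y]] V_def span_base)
      finally show "signed_integral ?M \<nu> (\<lambda>x. k x y) = 0" .
    qed
    also have "\<dots> = 0" by (simp add: signed_integral_def)
    finally show False by simp
  qed
  then obtain g where g: "g \<in> V" "dist g (?E f) < e"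
    using e unfolding closure_approachable by blast
  define h where "h x = apply_bcontfun g (discrete x)" for x
  have "(\<lambda>x. apply_bcontfun g (discrete x)) \<in> H \<inter> C0 \<Omega>"
    using g(1) unfolding V_def
  proof (induction rule: span_induct_alt)
    case base
    then show ?case by (simp add: zero_mem C0_zero)
  next
    case (step c u v)
    then obtain x where x: "x \<in> \<Omega>" "u = ?E (k x)" by blast
    have u: "(\<lambda>y. apply_bcontfun u (discrete y)) = (\<lambda>y. if y \<in> \<Omega> then k x y else 0)"
      by (auto simp: fun_eq_iff x E[OF kC] discrete_inverse)
    have "(\<lambda>y. if y \<in> \<Omega> then k x y else 0) \<in> C0 \<Omega>"
      by (rule C0_dominated[OF _ kC[OF x(1)], of _ 1])
        (use C0_D(1)[OF kC[OF x(1)]] in \<open>auto cong: continuous_on_cong\<close>)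
    then have "(\<lambda>y. apply_bcontfun u (discrete y)) \<in> H \<inter> C0 \<Omega>"
      unfolding u using section_mem[OF x(1)] by blast
    then show ?case using step(2) by (auto intro: add_mem scale_mem C0_add C0_scale)
  qed
  then have "h \<in> H \<inter> C0 \<Omega>" by (simp add: h_def[abs_def])
  moreover have "\<bar>f x - h x\<bar> \<le> e" if "x \<in> \<Omega>" for x
  proof -
    have "dist (h x) (apply_bcontfun (?E f) (discrete x)) \<le> dist g (?E f)"
      unfolding h_def by (rule dist_bounded)
    then show ?thesis using that g(2) by (simp add: E[OF f] discrete_inverse dist_real_def abs_minus_commute)
  qed
  ultimately show ?thesis by blast
qed

section \<open>Continuity of the exponential map\<close>

lemma exp_A_le:
  fixes f g :: "'a::euclidean_space \<Rightarrow> real"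
  assumes q0: "probability_density_on \<Omega> q0" and \<Omega>: "\<Omega> \<in> sets lebesgue"
    and g: "g \<in> borel_measurable (lebesgue_on \<Omega>)" and le: "\<And>x. x \<in> \<Omega> \<Longrightarrow> f x \<le> g x + c"
  shows "exp_A \<Omega> q0 f \<le> ennreal (exp c) * exp_A \<Omega> q0 g"
proof -
  have [measurable]: "q0 \<in> borel_measurable (lebesgue_on \<Omega>)" and q0_nn: "\<And>x. x \<in> \<Omega> \<Longrightarrow> 0 \<le> q0 x"
    using q0 by (auto simp: probability_density_on_def)
  note g [measurable]
  have "exp_A \<Omega> q0 f \<le> (\<integral>\<^sup>+x. ennreal (exp c) * ennreal (exp (g x) * q0 x) \<partial>lebesgue_on \<Omega>)"
    unfolding exp_A_def
  proof (rule nn_integral_mono)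
    fix x assume "x \<in> space (lebesgue_on \<Omega>)"
    then have x: "x \<in> \<Omega>" using \<Omega> by (simp add: space_restrict_space)
    have "exp (f x) * q0 x \<le> exp (g x + c) * q0 x"
      using le[OF x] q0_nn[OF x] by (intro mult_right_mono) auto
    also have "\<dots> = exp c * (exp (g x) * q0 x)" by (simp add: exp_add)
    finally have "ennreal (exp (f x) * q0 x) \<le> ennreal (exp c * (exp (g x) * q0 x))"
      by (rule ennreal_leI)
    also have "\<dots> = ennreal (exp c) * ennreal (exp (g x) * q0 x)"
      using q0_nn[OF x] by (intro ennreal_mult) auto
    finally show "ennreal (exp (f x) * q0 x) \<le> ennreal (exp c) * ennreal (exp (g x) * q0 x)" .
  qed
  also have "\<dots> = ennreal (exp c) * exp_A \<Omega> q0 g"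
    unfolding exp_A_def by (rule nn_integral_cmult) measurable
  finally show ?thesis .
qed

lemma exp_A_0: "probability_density_on \<Omega> q0 \<Longrightarrow> exp_A \<Omega> q0 (\<lambda>x. 0) = 1"
  by (simp add: exp_A_def probability_density_on_def)

lemma exp_A_positive_finite:
  fixes f :: "'a::euclidean_space \<Rightarrow> real"
  assumes q0: "probability_density_on \<Omega> q0" and \<Omega>: "\<Omega> \<in> sets lebesgue"
    and f: "f \<in> borel_measurable (lebesgue_on \<Omega>)" and B: "\<And>x. x \<in> \<Omega> \<Longrightarrow> \<bar>f x\<bar> \<le> B"
  shows "0 < exp_A \<Omega> q0 f" "exp_A \<Omega> q0 f < \<infinity>"
proof -
  have "1 \<le> ennreal (exp B) * exp_A \<Omega> q0 f"
    using exp_A_le[OF q0 \<Omega> f, of "\<lambda>x. 0" B] B exp_A_0[OF q0] by (force simp: abs_le_iff)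
  then show "0 < exp_A \<Omega> q0 f" by (cases "exp_A \<Omega> q0 f = 0") (auto simp: zero_less_iff_neq_zero)
  have "exp_A \<Omega> q0 f \<le> ennreal (exp B)"
    using exp_A_le[OF q0 \<Omega> borel_measurable_const, of f 0 B] B exp_A_0[OF q0] by (force simp: abs_le_iff)
  then show "exp_A \<Omega> q0 f < \<infinity>" by (rule order_le_less_trans) simp
qed

text \<open>\<open>A\<close> is monotone and commutes with adding constants, hence Lipschitz for the supremum norm.\<close>
lemma log_partition_le:
  fixes f g :: "'a::euclidean_space \<Rightarrow> real"
  assumes q0: "probability_density_on \<Omega> q0" and \<Omega>: "\<Omega> \<in> sets lebesgue"
    and f: "f \<in> borel_measurable (lebesgue_on \<Omega>)" "\<And>x. x \<in> \<Omega> \<Longrightarrow> \<bar>f x\<bar> \<le> B"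
    and g: "g \<in> borel_measurable (lebesgue_on \<Omega>)" "\<And>x. x \<in> \<Omega> \<Longrightarrow> \<bar>g x\<bar> \<le> C"
    and le: "\<And>x. x \<in> \<Omega> \<Longrightarrow> f x \<le> g x + c"
  shows "log_partition \<Omega> q0 f \<le> log_partition \<Omega> q0 g + c"
proof -
  note F = exp_A_positive_finite[OF q0 \<Omega> f] and G = exp_A_positive_finite[OF q0 \<Omega> g]
  have pos: "0 < enn2real (exp_A \<Omega> q0 f)" "0 < enn2real (exp_A \<Omega> q0 g)"
    using F G by (simp_all add: enn2real_positive_iff)
  have "enn2real (exp_A \<Omega> q0 f) \<le> enn2real (ennreal (exp c) * exp_A \<Omega> q0 g)"
    using exp_A_le[OF q0 \<Omega> g(1) le] G(2) by (intro enn2real_mono) (auto simp: ennreal_mult_less_top)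
  also have "\<dots> = exp c * enn2real (exp_A \<Omega> q0 g)" by (simp add: enn2real_mult)
  finally have "ln (enn2real (exp_A \<Omega> q0 f)) \<le> ln (exp c * enn2real (exp_A \<Omega> q0 g))"
    using pos by simp
  then show ?thesis using pos by (simp add: log_partition_def ln_mult)
qed

lemma exp_density_measurable:
  assumes "probability_density_on \<Omega> q0" "f \<in> borel_measurable (lebesgue_on \<Omega>)"
  shows "exp_density \<Omega> q0 f \<in> borel_measurable (lebesgue_on \<Omega>)"
proof -
  have [measurable]: "q0 \<in> borel_measurable (lebesgue_on \<Omega>)" "f \<in> borel_measurable (lebesgue_on \<Omega>)"
    using assms by (auto simp: probability_density_on_def)
  show ?thesis unfolding exp_density_def[abs_def] by measurable
qed

lemma exp_density_nonneg: "probability_density_on \<Omega> q0 \<Longrightarrow> x \<in> \<Omega> \<Longrightarrow> 0 \<le> exp_density \<Omega> q0 f x"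
  by (simp add: exp_density_def probability_density_on_def)

lemma nn_integral_exp_density:
  fixes f :: "'a::euclidean_space \<Rightarrow> real"
  assumes q0: "probability_density_on \<Omega> q0" and \<Omega>: "\<Omega> \<in> sets lebesgue"
    and f: "f \<in> borel_measurable (lebesgue_on \<Omega>)" "\<And>x. x \<in> \<Omega> \<Longrightarrow> \<bar>f x\<bar> \<le> B"
  shows "(\<integral>\<^sup>+x. ennreal (exp_density \<Omega> q0 f x) \<partial>lebesgue_on \<Omega>) = 1"
proof -
  have [measurable]: "q0 \<in> borel_measurable (lebesgue_on \<Omega>)" "f \<in> borel_measurable (lebesgue_on \<Omega>)"
    using q0 f(1) by (auto simp: probability_density_on_def)
  note F = exp_A_positive_finite[OF q0 \<Omega> f]
  define Z where "Z = enn2real (exp_A \<Omega> q0 f)"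
  have Z: "0 < Z" "ennreal Z = exp_A \<Omega> q0 f"
    using F by (simp_all add: Z_def enn2real_positive_iff)
  have "ennreal (exp_density \<Omega> q0 f x) = ennreal (1 / Z) * ennreal (exp (f x) * q0 x)" for x
  proof -
    have "exp_density \<Omega> q0 f x = 1 / Z * (exp (f x) * q0 x)"
      using Z(1) by (simp add: exp_density_def log_partition_def Z_def[symmetric] exp_diff)
    then show ?thesis using Z(1) by (simp only:) (intro ennreal_mult', simp)
  qed
  then have "(\<integral>\<^sup>+x. ennreal (exp_density \<Omega> q0 f x) \<partial>lebesgue_on \<Omega>) = ennreal (1 / Z) * exp_A \<Omega> q0 f"
    unfolding exp_A_def by (simp add: nn_integral_cmult)
  also have "\<dots> = 1" using Z(1) by (simp add: Z(2)[symmetric] ennreal_mult'[symmetric])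
  finally show ?thesis .
qed

text \<open>The same inequality for all exponents at once, including the essential supremum, so that the
  total variation, Hellinger and \<open>L\<^sup>r\<close> distances can be treated alike.\<close>
lemma Lp_norm_le:
  fixes u v :: "'b \<Rightarrow> real"
  assumes u: "u \<in> borel_measurable M" and v: "v \<in> borel_measurable M" and c: "0 \<le> c" and r: "0 < r"
    and le: "\<And>x. x \<in> space M \<Longrightarrow> \<bar>u x\<bar> \<le> c * \<bar>v x\<bar>" and fin: "Lp_norm r M v < \<infinity>"
  shows "Lp_norm r M u \<le> ennreal c * Lp_norm r M v"
proof (cases "r = \<infinity>")
  case True
  have "AE x in M. ennreal \<bar>v x\<bar> \<le> esssup M (\<lambda>x. ennreal \<bar>v x\<bar>)" by (rule esssup_AE)
  then have "AE x in M. ennreal \<bar>u x\<bar> \<le> ennreal c * esssup M (\<lambda>x. ennreal \<bar>v x\<bar>)"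
  proof (rule AE_mp, intro AE_I2 impI)
    fix x assume x: "x \<in> space M" and "ennreal \<bar>v x\<bar> \<le> esssup M (\<lambda>x. ennreal \<bar>v x\<bar>)"
    then have "ennreal c * ennreal \<bar>v x\<bar> \<le> ennreal c * esssup M (\<lambda>x. ennreal \<bar>v x\<bar>)"
      by (intro mult_left_mono) auto
    moreover have "ennreal \<bar>u x\<bar> \<le> ennreal c * ennreal \<bar>v x\<bar>"
      using le[OF x] c by (simp add: ennreal_mult[symmetric])
    ultimately show "ennreal \<bar>u x\<bar> \<le> ennreal c * esssup M (\<lambda>x. ennreal \<bar>v x\<bar>)" by (rule order_trans[rotated])
  qed
  then have "esssup M (\<lambda>x. ennreal \<bar>u x\<bar>) \<le> ennreal c * esssup M (\<lambda>x. ennreal \<bar>v x\<bar>)"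
    using u by (intro esssup_I) simp_all
  then show ?thesis using True by (simp add: Lp_norm_def)
next
  case False
  define s where "s = enn2real r"
  have s: "0 < s" using r False by (simp add: s_def enn2real_positive_iff less_top)
  let ?I = "\<lambda>u. \<integral>\<^sup>+x. ennreal (\<bar>u x\<bar> powr s) \<partial>M"
  have vI: "?I v \<noteq> \<infinity>" using fin False by (auto simp: Lp_norm_def Let_def s_def[symmetric])
  have "?I u \<le> (\<integral>\<^sup>+x. ennreal (c powr s) * ennreal (\<bar>v x\<bar> powr s) \<partial>M)"
  proof (rule nn_integral_mono)
    fix x assume "x \<in> space M"
    then have "\<bar>u x\<bar> powr s \<le> (c * \<bar>v x\<bar>) powr s" using s by (intro powr_mono2 le) auto
    also have "\<dots> = c powr s * \<bar>v x\<bar> powr s" using c by (simp add: powr_mult)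
    finally show "ennreal (\<bar>u x\<bar> powr s) \<le> ennreal (c powr s) * ennreal (\<bar>v x\<bar> powr s)"
      by (simp add: ennreal_mult[symmetric])
  qed
  also have "\<dots> = ennreal (c powr s) * ?I v" using v by (intro nn_integral_cmult) simp
  finally have uv: "?I u \<le> ennreal (c powr s) * ?I v" .
  have fin2: "ennreal (c powr s) * ?I v < \<infinity>" using vI by (simp add: ennreal_mult_less_top less_top)
  then have uI: "?I u \<noteq> \<infinity>" using uv by (auto simp: top_unique)
  have "enn2real (?I u) \<le> c powr s * enn2real (?I v)"
    using enn2real_mono[OF uv] fin2 by (simp add: enn2real_mult)
  then have "enn2real (?I u) powr (1 / s) \<le> (c powr s * enn2real (?I v)) powr (1 / s)"
    using s by (intro powr_mono2) auto
  also have "\<dots> = c * enn2real (?I v) powr (1 / s)"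
    using s c by (simp add: powr_mult powr_powr)
  finally show ?thesis
    using False uI vI c
    by (simp add: Lp_norm_def Let_def s_def[symmetric] ennreal_mult[symmetric] ennreal_leI)
qed

lemma abs_exp_minus_1_le:
  fixes t s :: real
  assumes "\<bar>t\<bar> \<le> s"
  shows "\<bar>exp t - 1\<bar> \<le> exp s - 1"
proof (cases "0 \<le> t")
  case True
  then show ?thesis using assms by simp
next
  case False
  have "1 - exp t \<le> exp (- t) - 1"
    using exp_ge_add_one_self[of t] exp_ge_add_one_self[of "- t"] by linarith
  also have "\<dots> \<le> exp s - 1" using assms by simp
  finally show ?thesis using False by simp
qed

text \<open>Two exponents that are uniformly \<open>e\<close>-close. Their partition functions differ by a factor of at most
  \<open>exp e\<close>, so the logarithm of the ratio of the two densities is at most \<open>2 e\<close> everywhere. Each of the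
  distances is controlled by this pointwise bound alone.\<close>
locale uniformly_close_potentials =
  fixes \<Omega> :: "'a::euclidean_space set" and q0 f g :: "'a \<Rightarrow> real" and B C e :: real
  assumes q0: "probability_density_on \<Omega> q0" and \<Omega>: "\<Omega> \<in> sets lebesgue"
    and f: "f \<in> borel_measurable (lebesgue_on \<Omega>)" "\<And>x. x \<in> \<Omega> \<Longrightarrow> \<bar>f x\<bar> \<le> B"
    and g: "g \<in> borel_measurable (lebesgue_on \<Omega>)" "\<And>x. x \<in> \<Omega> \<Longrightarrow> \<bar>g x\<bar> \<le> C"
    and close: "\<And>x. x \<in> \<Omega> \<Longrightarrow> \<bar>f x - g x\<bar> \<le> e" and e: "0 \<le> e"
begin

abbreviation "p \<equiv> exp_density \<Omega> q0 f"
abbreviation "q \<equiv> exp_density \<Omega> q0 g"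

definition log_ratio :: "'a \<Rightarrow> real" where
  "log_ratio x = (g x - log_partition \<Omega> q0 g) - (f x - log_partition \<Omega> q0 f)"

lemma log_ratio_le: "x \<in> \<Omega> \<Longrightarrow> \<bar>log_ratio x\<bar> \<le> 2 * e"
proof -
  assume x: "x \<in> \<Omega>"
  have "log_partition \<Omega> q0 f \<le> log_partition \<Omega> q0 g + e"
    using close by (intro log_partition_le[OF q0 \<Omega> f g]) (auto simp: abs_le_iff algebra_simps)
  moreover have "log_partition \<Omega> q0 g \<le> log_partition \<Omega> q0 f + e"
    using close by (intro log_partition_le[OF q0 \<Omega> g f]) (auto simp: abs_le_iff algebra_simps)
  ultimately show "\<bar>log_ratio x\<bar> \<le> 2 * e" using close[OF x] by (simp add: log_ratio_def abs_le_iff)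
qed

lemma q_eq: "q x = exp (log_ratio x) * p x"
  unfolding exp_density_def mult.assoc[symmetric] exp_add[symmetric] by (simp add: log_ratio_def)

lemma space: "space (lebesgue_on \<Omega>) = \<Omega>"
  using \<Omega> by (simp add: space_restrict_space)

lemmas p_meas = exp_density_measurable[OF q0 f(1)] and q_meas = exp_density_measurable[OF q0 g(1)]
lemmas p_nonneg = exp_density_nonneg[OF q0, of _ f]

lemma p_integral: "integrable (lebesgue_on \<Omega>) p" "integral\<^sup>L (lebesgue_on \<Omega>) p = 1"
proof -
  have nn: "AE x in lebesgue_on \<Omega>. 0 \<le> p x" by (intro AE_I2 p_nonneg) (simp add: space)
  note 1 = nn_integral_exp_density[OF q0 \<Omega> f]
  show "integrable (lebesgue_on \<Omega>) p" by (rule integrableI_nonneg[OF p_meas nn]) (simp add: 1)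
  show "integral\<^sup>L (lebesgue_on \<Omega>) p = 1" using integral_eq_nn_integral[OF p_meas nn] by (simp add: 1)
qed

lemma KL_le: "KL \<Omega> p q \<le> ereal (2 * e)"
proof -
  have eq: "p x * ln (p x / q x) = - log_ratio x * p x" for x
  proof (cases "p x = 0")
    case False
    then have "p x / q x = exp (- log_ratio x)" by (simp add: q_eq exp_minus field_simps)
    then show ?thesis by simp
  qed simp
  have bd: "\<bar>- log_ratio x * p x\<bar> \<le> 2 * e * p x" if "x \<in> \<Omega>" for x
    using log_ratio_le[OF that] p_nonneg[OF that] by (simp add: abs_mult mult_right_mono)
  have [measurable]: "f \<in> borel_measurable (lebesgue_on \<Omega>)" "g \<in> borel_measurable (lebesgue_on \<Omega>)"
    "p \<in> borel_measurable (lebesgue_on \<Omega>)"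
    by (rule f g p_meas)+
  have "integrable (lebesgue_on \<Omega>) (\<lambda>x. - log_ratio x * p x)"
  proof (rule Bochner_Integration.integrable_bound)
    show "integrable (lebesgue_on \<Omega>) (\<lambda>x. 2 * e * p x)" using p_integral(1) by simp
    show "(\<lambda>x. - log_ratio x * p x) \<in> borel_measurable (lebesgue_on \<Omega>)" unfolding log_ratio_def by measurable
    show "AE x in lebesgue_on \<Omega>. norm (- log_ratio x * p x) \<le> norm (2 * e * p x)"
      using bd by (intro AE_I2) (fastforce simp: space)
  qed
  then have int: "integrable (lebesgue_on \<Omega>) (\<lambda>x. p x * ln (p x / q x))" by (simp only: eq)
  have "(\<integral>x. p x * ln (p x / q x) \<partial>lebesgue_on \<Omega>) \<le> (\<integral>x. 2 * e * p x \<partial>lebesgue_on \<Omega>)"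
  proof (rule integral_mono[OF int])
    show "integrable (lebesgue_on \<Omega>) (\<lambda>x. 2 * e * p x)" using p_integral(1) by simp
    show "p x * ln (p x / q x) \<le> 2 * e * p x" if "x \<in> space (lebesgue_on \<Omega>)" for x
      unfolding eq using bd[of x] that by (simp add: space abs_le_iff)
  qed
  also have "\<dots> = 2 * e" using p_integral(2) by simp
  finally show ?thesis using int by (simp add: KL_def q_eq)
qed

lemma Lr_dist_le:
  assumes r: "0 < r" and fin: "Lp_norm r (lebesgue_on \<Omega>) q0 < \<infinity>"
  shows "Lr_dist r \<Omega> p q \<le> enn2ereal (ennreal ((exp (2 * e) - 1) * exp (2 * B)) * Lp_norm r (lebesgue_on \<Omega>) q0)"
  unfolding Lr_dist_def less_eq_ennreal.rep_eq[symmetric]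
proof (rule Lp_norm_le[OF _ _ _ r _ fin])
  show "(\<lambda>x. p x - q x) \<in> borel_measurable (lebesgue_on \<Omega>)" using p_meas q_meas by simp
  show "q0 \<in> borel_measurable (lebesgue_on \<Omega>)" using q0 by (simp add: probability_density_on_def)
  show "0 \<le> (exp (2 * e) - 1) * exp (2 * B)" using e by simp
  fix x assume "x \<in> space (lebesgue_on \<Omega>)"
  then have x: "x \<in> \<Omega>" by (simp add: space)
  have "log_partition \<Omega> q0 (\<lambda>x. 0) \<le> log_partition \<Omega> q0 f + B"
    using f(2) by (intro log_partition_le[OF q0 \<Omega> _ _ f, of _ 0]) (force simp: abs_le_iff)+
  then have "- log_partition \<Omega> q0 f \<le> B" by (simp add: log_partition_def exp_A_0[OF q0])
  then have "f x - log_partition \<Omega> q0 f \<le> 2 * B" using f(2)[OF x] by (simp add: abs_le_iff)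
  then have pq: "p x \<le> exp (2 * B) * \<bar>q0 x\<bar>"
    using q0 x by (auto simp: exp_density_def probability_density_on_def intro!: mult_right_mono)
  have "\<bar>p x - q x\<bar> = \<bar>(exp (log_ratio x) - 1) * p x\<bar>"
    by (simp add: q_eq left_diff_distrib abs_minus_commute)
  also have "\<dots> = \<bar>exp (log_ratio x) - 1\<bar> * p x"
    using p_nonneg[OF x] by (simp add: abs_mult)
  also have "\<dots> \<le> (exp (2 * e) - 1) * (exp (2 * B) * \<bar>q0 x\<bar>)"
    using abs_exp_minus_1_le[OF log_ratio_le[OF x]] e p_nonneg[OF x] pq by (intro mult_mono) auto
  finally show "\<bar>p x - q x\<bar> \<le> (exp (2 * e) - 1) * exp (2 * B) * \<bar>q0 x\<bar>" by (simp add: mult.assoc)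
qed

lemma Hellinger_dist_le: "Hellinger_dist \<Omega> p q \<le> ereal (exp e - 1)"
proof -
  have "(\<integral>\<^sup>+x. ennreal (\<bar>sqrt (p x)\<bar> powr 2) \<partial>lebesgue_on \<Omega>) = (\<integral>\<^sup>+x. ennreal (p x) \<partial>lebesgue_on \<Omega>)"
    using p_nonneg by (intro nn_integral_cong) (simp add: space powr_numeral)
  also have "\<dots> = 1" by (rule nn_integral_exp_density[OF q0 \<Omega> f])
  finally have norm1: "Lp_norm 2 (lebesgue_on \<Omega>) (\<lambda>x. sqrt (p x)) = 1"
    by (simp add: Lp_norm_def)
  have "Lp_norm 2 (lebesgue_on \<Omega>) (\<lambda>x. sqrt (p x) - sqrt (q x)) \<le>
      ennreal (exp e - 1) * Lp_norm 2 (lebesgue_on \<Omega>) (\<lambda>x. sqrt (p x))"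
  proof (rule Lp_norm_le)
    show "(\<lambda>x. sqrt (p x) - sqrt (q x)) \<in> borel_measurable (lebesgue_on \<Omega>)"
      "(\<lambda>x. sqrt (p x)) \<in> borel_measurable (lebesgue_on \<Omega>)"
      using p_meas q_meas by (auto intro: borel_measurable_diff)
    show "0 \<le> exp e - 1" using e by simp
    fix x assume "x \<in> space (lebesgue_on \<Omega>)"
    then have x: "x \<in> \<Omega>" by (simp add: space)
    have "sqrt (exp (log_ratio x)) = exp (log_ratio x / 2)"
      by (rule real_sqrt_unique) (simp_all add: power2_eq_square flip: exp_add)
    then have "sqrt (q x) = exp (log_ratio x / 2) * sqrt (p x)" by (simp add: q_eq real_sqrt_mult)
    then have "\<bar>sqrt (p x) - sqrt (q x)\<bar> = \<bar>(exp (log_ratio x / 2) - 1) * sqrt (p x)\<bar>"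
      by (simp add: left_diff_distrib abs_minus_commute)
    also have "\<dots> \<le> (exp e - 1) * \<bar>sqrt (p x)\<bar>"
      unfolding abs_mult using log_ratio_le[OF x] by (intro mult_right_mono abs_exp_minus_1_le) auto
    finally show "\<bar>sqrt (p x) - sqrt (q x)\<bar> \<le> (exp e - 1) * \<bar>sqrt (p x)\<bar>" .
  qed (simp_all add: norm1)
  then have "Hellinger_dist \<Omega> p q \<le> enn2ereal (ennreal (exp e - 1))"
    unfolding Hellinger_dist_def Lr_dist_def less_eq_ennreal.rep_eq[symmetric] by (simp add: norm1)
  also have "\<dots> = ereal (exp e - 1)" using e by (simp add: enn2ereal_ennreal)
  finally show ?thesis .
qed

end

section \<open>Density of the exponential family\<close>

lemma close_exp_family_member:
  fixes \<Omega> :: "'a::euclidean_space set"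
  assumes lc: "locally compact \<Omega>" and q0: "probability_density_on \<Omega> q0"
    and dense: "\<And>e. 0 < e \<Longrightarrow> \<exists>g\<in>H \<inter> C0 \<Omega>. \<forall>x\<in>\<Omega>. \<bar>f x - g x\<bar> \<le> e"
    and f: "f \<in> C0 \<Omega>" "\<And>x. x \<in> \<Omega> \<Longrightarrow> \<bar>f x\<bar> \<le> B" and e: "0 < e"
  obtains g C where "exp_density \<Omega> q0 g \<in> exp_family \<Omega> q0 H"
    and "uniformly_close_potentials \<Omega> q0 f g B C e"
proof -
  \<comment> \<open>a locally compact subset of a Euclidean space is Borel, being open in its closure\<close>
  obtain T where T: "open T" "\<Omega> = T \<inter> closure \<Omega>"
    using locally_compact_open_Int_closure[OF lc] by blast
  have "T \<inter> closure \<Omega> \<in> sets borel" using T(1) by (intro sets.Int) auto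
  then have "\<Omega> \<in> sets borel" using T(2) by simp
  then have \<Omega>: "\<Omega> \<in> sets lebesgue" by (rule sets_completionI_sets[of _ lborel, simplified])
  have meas: "h \<in> borel_measurable (lebesgue_on \<Omega>)" if "h \<in> C0 \<Omega>" for h
    by (rule continuous_imp_measurable_on_sets_lebesgue[OF C0_D(1)[OF that] \<Omega>])
  obtain g where g: "g \<in> H" "g \<in> C0 \<Omega>" "\<forall>x\<in>\<Omega>. \<bar>f x - g x\<bar> \<le> e" using dense[OF e] by blast
  obtain C where C: "\<And>x. x \<in> \<Omega> \<Longrightarrow> \<bar>g x\<bar> \<le> C" using C0_bounded[OF g(2)] by blast
  have "exp_A \<Omega> q0 g < \<infinity>" by (rule exp_A_positive_finite(2)[OF q0 \<Omega> meas[OF g(2)] C])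
  then have "exp_density \<Omega> q0 g \<in> exp_family \<Omega> q0 H" using g(1) by (auto simp: exp_family_def)
  moreover have "uniformly_close_potentials \<Omega> q0 f g B C e"
    by unfold_locales (use q0 \<Omega> meas f g C e in auto)
  ultimately show thesis by (rule that)
qed

text \<open>The case \<open>r = 1\<close>, where the norm of a probability density is finite automatically, is the total
  variation distance.\<close>
lemma exp_family_dense_Lr:
  fixes \<Omega> :: "'a::euclidean_space set"
  assumes lc: "locally compact \<Omega>" and q0: "probability_density_on \<Omega> q0"
    and dense: "\<And>f e. f \<in> C0 \<Omega> \<Longrightarrow> 0 < e \<Longrightarrow> \<exists>g\<in>H \<inter> C0 \<Omega>. \<forall>x\<in>\<Omega>. \<bar>f x - g x\<bar> \<le> e"
    and r: "0 < r" and fin: "Lp_norm r (lebesgue_on \<Omega>) q0 < \<infinity>"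
  shows "dense_wrt (Lr_dist r \<Omega>) (exp_family \<Omega> q0 H) (C0_family \<Omega> q0)"
  unfolding dense_wrt_def C0_family_def
proof (intro ballI allI impI, elim imageE)
  fix \<pi> f and \<epsilon> :: real assume \<pi>: "\<pi> = exp_density \<Omega> q0 f" and f: "f \<in> C0 \<Omega>" and \<epsilon>: "0 < \<epsilon>"
  obtain B where B: "\<And>x. x \<in> \<Omega> \<Longrightarrow> \<bar>f x\<bar> \<le> B" using C0_bounded[OF f] by blast
  define N where "N = enn2real (Lp_norm r (lebesgue_on \<Omega>) q0)"
  have N: "0 \<le> N" "Lp_norm r (lebesgue_on \<Omega>) q0 = ennreal N" using fin by (simp_all add: N_def)
  define K where "K = exp (2 * B) * N + 1"
  have K: "0 < K" using N(1) by (simp add: K_def add_nonneg_pos)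
  \<comment> \<open>chosen such that \<open>(exp (2 e) - 1) * K = \<epsilon>\<close>; the summand 1 in \<open>K\<close> excludes \<open>K = 0\<close>\<close>
  define e where "e = ln (1 + \<epsilon> / K) / 2"
  have quot: "0 < \<epsilon> / K" using \<epsilon> K by simp
  then have e: "0 < e" by (simp add: e_def)
  have exp_e: "exp (2 * e) - 1 = \<epsilon> / K" using quot by (simp add: e_def)
  obtain g C where g: "exp_density \<Omega> q0 g \<in> exp_family \<Omega> q0 H"
    and close: "uniformly_close_potentials \<Omega> q0 f g B C e"
    by (rule close_exp_family_member[OF lc q0 dense[OF f] f B e])
  have "Lr_dist r \<Omega> \<pi> (exp_density \<Omega> q0 g) \<le> enn2ereal (ennreal (\<epsilon> / K * exp (2 * B)) * ennreal N)"
    using uniformly_close_potentials.Lr_dist_le[OF close r fin] unfolding \<pi> N(2) exp_e .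
  also have "\<dots> = ereal (\<epsilon> / K * exp (2 * B) * N)"
  proof -
    have nonneg: "0 \<le> \<epsilon> / K * exp (2 * B)"
      by (rule mult_nonneg_nonneg[OF less_imp_le[OF quot] exp_ge_zero])
    have "ennreal (\<epsilon> / K * exp (2 * B)) * ennreal N = ennreal (\<epsilon> / K * exp (2 * B) * N)"
      by (rule ennreal_mult[OF nonneg N(1), symmetric])
    moreover have "0 \<le> \<epsilon> / K * exp (2 * B) * N" by (rule mult_nonneg_nonneg[OF nonneg N(1)])
    ultimately show ?thesis by (simp only: enn2ereal_ennreal)
  qed
  also have "\<dots> \<le> ereal \<epsilon>"
  proof -
    have "\<epsilon> / K * exp (2 * B) * N = \<epsilon> / K * (K - 1)" by (simp add: K_def)
    also have "\<dots> \<le> \<epsilon> / K * K" using quot by (intro mult_left_mono) auto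
    finally show ?thesis using K by simp
  qed
  finally show "\<exists>p\<in>exp_family \<Omega> q0 H. Lr_dist r \<Omega> \<pi> p \<le> ereal \<epsilon>" using g by blast
qed

theorem proposition1:
  fixes \<Omega> :: "'a::euclidean_space set"
    and q0 :: "'a \<Rightarrow> real"
    and k :: "'a \<Rightarrow> 'a \<Rightarrow> real"
    and H :: "('a \<Rightarrow> real) set"
    and ip :: "('a \<Rightarrow> real) \<Rightarrow> ('a \<Rightarrow> real) \<Rightarrow> real"
  assumes "locally compact \<Omega>"
    and "probability_density_on \<Omega> q0"
    and "positive_definite_kernel \<Omega> k"
    and "rkhs \<Omega> k H ip"
    and "\<And>x. x \<in> \<Omega> \<Longrightarrow> k x \<in> C0 \<Omega>"
    and "\<And>\<mu>. \<mu> \<in> Mb \<Omega> - {\<lambda>_. 0} \<Longrightarrow>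
           signed_integral (restrict_space borel \<Omega>) \<mu>
             (\<lambda>y. signed_integral (restrict_space borel \<Omega>) \<mu> (\<lambda>x. k x y)) > 0"
  shows "dense_wrt (KL \<Omega>) (exp_family \<Omega> q0 H) (C0_family \<Omega> q0)
       \<and> dense_wrt (TV_dist \<Omega>) (exp_family \<Omega> q0 H) (C0_family \<Omega> q0)
       \<and> dense_wrt (Hellinger_dist \<Omega>) (exp_family \<Omega> q0 H) (C0_family \<Omega> q0)
       \<and> (\<forall>r::ennreal. 1 < r \<longrightarrow>
            q0 \<in> Lp_space 1 (lebesgue_on \<Omega>) \<inter> Lp_space r (lebesgue_on \<Omega>) \<longrightarrow>
            dense_wrt (Lr_dist r \<Omega>) (exp_family \<Omega> q0 H) (C0_family \<Omega> q0))"
proof -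
  note lc = assms(1) and q0 = assms(2)
  have dense: "\<exists>g\<in>H \<inter> C0 \<Omega>. \<forall>x\<in>\<Omega>. \<bar>f x - g x\<bar> \<le> e" if "f \<in> C0 \<Omega>" "0 < e" for f e
    by (rule kernel_sections_dense_in_C0[OF assms(1,3,4,5,6) that])
  have potentials: thesis
    if f: "f \<in> C0 \<Omega>" and e: "0 < e" and thesis: "\<And>g B C. exp_density \<Omega> q0 g \<in> exp_family \<Omega> q0 H \<Longrightarrow>
      uniformly_close_potentials \<Omega> q0 f g B C e \<Longrightarrow> thesis" for f e thesis
  proof -
    obtain B where B: "\<And>x. x \<in> \<Omega> \<Longrightarrow> \<bar>f x\<bar> \<le> B" using C0_bounded[OF f] by blast
    show thesis
      by (rule close_exp_family_member[OF lc q0 dense[OF f] f B e]) (assumption | rule thesis)+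
  qed
  have "dense_wrt (KL \<Omega>) (exp_family \<Omega> q0 H) (C0_family \<Omega> q0)"
    unfolding dense_wrt_def C0_family_def
  proof (intro ballI allI impI, elim imageE)
    fix \<pi> f and \<epsilon> :: real assume \<pi>: "\<pi> = exp_density \<Omega> q0 f" and f: "f \<in> C0 \<Omega>" and "0 < \<epsilon>"
    then have e: "0 < \<epsilon> / 2" by simp
    show "\<exists>p\<in>exp_family \<Omega> q0 H. KL \<Omega> \<pi> p \<le> ereal \<epsilon>"
    proof (rule potentials[OF f e])
      fix g B C assume g: "exp_density \<Omega> q0 g \<in> exp_family \<Omega> q0 H"
        and close: "uniformly_close_potentials \<Omega> q0 f g B C (\<epsilon> / 2)"
      show ?thesis using uniformly_close_potentials.KL_le[OF close] g \<pi> by auto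
    qed
  qed
  moreover have "dense_wrt (Hellinger_dist \<Omega>) (exp_family \<Omega> q0 H) (C0_family \<Omega> q0)"
    unfolding dense_wrt_def C0_family_def
  proof (intro ballI allI impI, elim imageE)
    fix \<pi> f and \<epsilon> :: real assume \<pi>: "\<pi> = exp_density \<Omega> q0 f" and f: "f \<in> C0 \<Omega>" and \<epsilon>: "0 < \<epsilon>"
    then have e: "0 < ln (1 + \<epsilon>)" by simp
    show "\<exists>p\<in>exp_family \<Omega> q0 H. Hellinger_dist \<Omega> \<pi> p \<le> ereal \<epsilon>"
    proof (rule potentials[OF f e])
      fix g B C assume g: "exp_density \<Omega> q0 g \<in> exp_family \<Omega> q0 H"
        and close: "uniformly_close_potentials \<Omega> q0 f g B C (ln (1 + \<epsilon>))"
      have "exp (ln (1 + \<epsilon>)) - 1 = \<epsilon>" using \<epsilon> by simp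
      then show ?thesis using uniformly_close_potentials.Hellinger_dist_le[OF close] g \<pi> by auto
    qed
  qed
  moreover have "dense_wrt (TV_dist \<Omega>) (exp_family \<Omega> q0 H) (C0_family \<Omega> q0)"
  proof -
    have "(\<integral>\<^sup>+x. ennreal (\<bar>q0 x\<bar> powr 1) \<partial>lebesgue_on \<Omega>) = (\<integral>\<^sup>+x. ennreal (q0 x) \<partial>lebesgue_on \<Omega>)"
      using q0 by (intro nn_integral_cong) (simp add: probability_density_on_def space_restrict_space)
    also have "\<dots> = 1" using q0 by (simp add: probability_density_on_def)
    finally have "Lp_norm 1 (lebesgue_on \<Omega>) q0 < \<infinity>" by (simp add: Lp_norm_def)
    then show ?thesis unfolding TV_dist_def[abs_def] by (intro exp_family_dense_Lr[OF lc q0 dense]) auto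
  qed
  moreover have "dense_wrt (Lr_dist r \<Omega>) (exp_family \<Omega> q0 H) (C0_family \<Omega> q0)"
    if "1 < r" "q0 \<in> Lp_space 1 (lebesgue_on \<Omega>) \<inter> Lp_space r (lebesgue_on \<Omega>)" for r
  proof (rule exp_family_dense_Lr[OF lc q0 dense])
    show "0 < r" by (rule less_trans[OF zero_less_one that(1)])
    show "Lp_norm r (lebesgue_on \<Omega>) q0 < \<infinity>" using that(2) by (simp add: Lp_space_def)
  qed
  ultimately show ?thesis by blast
qed

end
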